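(* There exists a $2$-star aligned graph $(G,\mathcal X)$ of alignment complexity $(\bot,1,\bot)$ (that is, every edge has exactly one endpoint on a pseudoline and is crossed in its interior by at most one pseudoline) that does not have an aligned drawing.
   Context: Let $G$ be a planar graph with a fixed planar embedding (drawing). A pseudoline with respect to $G$ is a simple curve, unbounded in both directions, that starts and ends in the outer face of $G$ and that, for each edge of $G$, either entirely contains that edge or intersects it at most once. An aligned graph is a pair $(G,\mathcal A)$ where $\mathcal A=\{\mathcal L_1,\dots,\mathcal L_k\}$ is a set of pseudolines with respect to $G$ that pairwise intersect at most once. The pseudolines divide the plane into cells. An aligned drawing of $(G,\mathcal A)$ is a pair $(\Gamma,A)$ where $\Gamma$ is a planar straight-line drawing of $G$ and $A=\{L_1,\dots,L_k\}$ is a set of straight lines ($L_i$ corresponding to $\mathcal L_i$) such that: (i) the arrangement $A$ is homeomorphic to the arrangement $\mathcal A$, which induces a bijection $\phi$ from the cells of $\mathcal A$ to the cells of $A$; (ii) $\Gamma$ is homeomorphic to the given planar embedding of $G$; (iii) a vertex or edge intersects a cell $C$ of $\mathcal A$ if and only if it intersects $\phi(C)$ in $(\Gamma,A)$; (iv) if an edge $uv$, traversed from $u$ to $v$, intersects cells $C_1,\dots,C_r$ in this order, then in $\Gamma$ it intersects $\phi(C_1),\dots,\phi(C_r)$ in this order; (v) each line $L_i$ intersects in $\Gamma$ the same vertices and edges as $\mathcal L_i$ in $G$, in the same order. An aligned graph $(G,\mathcal X)$ with $\mathcal X=\{\mathcal X_1,\dots,\mathcal X_k\}$ is a $k$-star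 aligned graph if all pseudolines pairwise intersect in one common point (the origin). An edge is $l$-crossed if exactly $l$ pseudolines intersect it in its interior; it is $i$-anchored if $i$ of its endpoints lie on $i$ distinct pseudolines. Let $E_i$ denote the set of $i$-anchored edges. For $l_0,l_1,l_2\in\mathbb N\cup\{\bot\}$, the aligned graph has alignment complexity $(l_0,l_1,l_2)$ if, for each $i$, $E_i$ is empty when $l_i=\bot$, and every edge of $E_i$ is at most $l_i$-crossed otherwise. *)

theory Defs
  imports "HOL-Analysis.Analysis"
begin

type_synonym pt = "real^2"

text \<open>Graphs: vertex set V of naturals, edges as ordered pairs (an orientation of each
undirected edge is fixed, the traversal direction used in condition (iv)).
A drawing assigns points to vertices and arcs (injective paths on [0,1]) to edges.\<close>

definition plane_drawing ::
  "nat set \<Rightarrow> (nat \<times> nat) set \<Rightarrow> (nat \<Rightarrow> pt) \<Rightarrow> (nat \<times> nat \<Rightarrow> real \<Rightarrow> pt) \<Rightarrow> bool" where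
  "plane_drawing V E pos c \<longleftrightarrow>
     finite V \<and> E \<subseteq> V \<times> V \<and> (\<forall>(u,v)\<in>E. u \<noteq> v \<and> (v,u) \<notin> E) \<and>
     inj_on pos V \<and>
     (\<forall>e\<in>E. arc (c e) \<and> pathstart (c e) = pos (fst e) \<and> pathfinish (c e) = pos (snd e)) \<and>
     (\<forall>e\<in>E. \<forall>w\<in>V. pos w \<notin> c e ` {0<..<1}) \<and>
     (\<forall>e\<in>E. \<forall>e'\<in>E. e \<noteq> e' \<longrightarrow>
        path_image (c e) \<inter> path_image (c e') \<subseteq> pos ` ({fst e, snd e} \<inter> {fst e', snd e'}))"

definition drawing_set ::
  "nat set \<Rightarrow> (nat \<times> nat) set \<Rightarrow> (nat \<Rightarrow> pt) \<Rightarrow> (nat \<times> nat \<Rightarrow> real \<Rightarrow> pt) \<Rightarrow> pt set" where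
  "drawing_set V E pos c = pos ` V \<union> (\<Union>e\<in>E. path_image (c e))"

definition crosses_at :: "(real \<Rightarrow> pt) \<Rightarrow> (real \<Rightarrow> pt) \<Rightarrow> real \<Rightarrow> bool" where
  "crosses_at l \<gamma> t \<longleftrightarrow>
     (\<exists>\<epsilon>>0. \<forall>a b. t - \<epsilon> < a \<and> a < t \<and> t < b \<and> b < t + \<epsilon> \<longrightarrow>
        \<gamma> a \<notin> range l \<and> \<gamma> b \<notin> range l \<and> \<not> connected_component (- range l) (\<gamma> a) (\<gamma> b))"

definition pseudoline ::
  "nat set \<Rightarrow> (nat \<times> nat) set \<Rightarrow> (nat \<Rightarrow> pt) \<Rightarrow> (nat \<times> nat \<Rightarrow> real \<Rightarrow> pt) \<Rightarrow> (real \<Rightarrow> pt) \<Rightarrow> bool" where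
  "pseudoline V E pos c l \<longleftrightarrow>
     continuous_on UNIV l \<and> inj l \<and>
     filterlim (\<lambda>t. norm (l t)) at_top at_top \<and> filterlim (\<lambda>t. norm (l t)) at_top at_bot \<and>
     eventually (\<lambda>t. l t \<in> outside (drawing_set V E pos c)) at_top \<and>
     eventually (\<lambda>t. l t \<in> outside (drawing_set V E pos c)) at_bot \<and>
     (\<forall>e\<in>E. path_image (c e) \<subseteq> range l \<or>
        ((\<forall>p q. p \<in> path_image (c e) \<inter> range l \<and> q \<in> path_image (c e) \<inter> range l \<longrightarrow> p = q) \<and>
         (\<forall>t\<in>{0<..<1}. c e t \<in> range l \<longrightarrow> crosses_at l (c e) t)))"

definition aligned_graph ::
  "nat set \<Rightarrow> (nat \<times> nat) set \<Rightarrow> (nat \<Rightarrow> pt) \<Rightarrow> (nat \<times> nat \<Rightarrow> real \<Rightarrow> pt) \<Rightarrow> nat \<Rightarrow> (nat \<Rightarrow> real \<Rightarrow> pt) \<Rightarrow> bool" where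
  "aligned_graph V E pos c k X \<longleftrightarrow>
     plane_drawing V E pos c \<and>
     (\<forall>i<k. pseudoline V E pos c (X i)) \<and>
     (\<forall>i<k. \<forall>j<k. i \<noteq> j \<longrightarrow>
        (\<forall>p q. p \<in> range (X i) \<inter> range (X j) \<and> q \<in> range (X i) \<inter> range (X j) \<longrightarrow> p = q) \<and>
        (\<forall>s. X j s \<in> range (X i) \<longrightarrow> crosses_at (X i) (X j) s))"

definition star_aligned_graph ::
  "nat set \<Rightarrow> (nat \<times> nat) set \<Rightarrow> (nat \<Rightarrow> pt) \<Rightarrow> (nat \<times> nat \<Rightarrow> real \<Rightarrow> pt) \<Rightarrow> nat \<Rightarrow> (nat \<Rightarrow> real \<Rightarrow> pt) \<Rightarrow> bool" where
  "star_aligned_graph V E pos c k X \<longleftrightarrow>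
     aligned_graph V E pos c k X \<and>
     (\<exists>org. \<forall>i<k. \<forall>j<k. i \<noteq> j \<longrightarrow> range (X i) \<inter> range (X j) = {org})"

text \<open>Anchoring: e is i-anchored iff i is the largest number of its endpoints that can be
placed on pairwise distinct pseudolines.\<close>

definition on_pl :: "nat \<Rightarrow> (nat \<Rightarrow> real \<Rightarrow> pt) \<Rightarrow> pt \<Rightarrow> bool" where
  "on_pl k X p \<longleftrightarrow> (\<exists>i<k. p \<in> range (X i))"

definition anchoring :: "(nat \<Rightarrow> pt) \<Rightarrow> nat \<Rightarrow> (nat \<Rightarrow> real \<Rightarrow> pt) \<Rightarrow> nat \<times> nat \<Rightarrow> nat" where
  "anchoring pos k X e =
     (if \<exists>i<k. \<exists>j<k. i \<noteq> j \<and> pos (fst e) \<in> range (X i) \<and> pos (snd e) \<in> range (X j) then 2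
      else if on_pl k X (pos (fst e)) \<or> on_pl k X (pos (snd e)) then 1 else 0)"

definition crossing_number ::
  "(nat \<times> nat \<Rightarrow> real \<Rightarrow> pt) \<Rightarrow> nat \<Rightarrow> (nat \<Rightarrow> real \<Rightarrow> pt) \<Rightarrow> nat \<times> nat \<Rightarrow> nat" where
  "crossing_number c k X e = card {i. i < k \<and> range (X i) \<inter> c e ` {0<..<1} \<noteq> {}}"

text \<open>Alignment complexity (l0,l1,l2); None encodes \<open>\<bottom>\<close>.\<close>

definition alignment_complexity ::
  "(nat \<times> nat) set \<Rightarrow> (nat \<Rightarrow> pt) \<Rightarrow> (nat \<times> nat \<Rightarrow> real \<Rightarrow> pt) \<Rightarrow> nat \<Rightarrow> (nat \<Rightarrow> real \<Rightarrow> pt)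
     \<Rightarrow> nat option \<Rightarrow> nat option \<Rightarrow> nat option \<Rightarrow> bool" where
  "alignment_complexity E pos c k X l0 l1 l2 \<longleftrightarrow>
     (\<forall>i\<in>{0,1,2::nat}. let l = [l0, l1, l2] ! i in
        (l = None \<longrightarrow> {e\<in>E. anchoring pos k X e = i} = {}) \<and>
        (\<forall>m. l = Some m \<longrightarrow> (\<forall>e\<in>E. anchoring pos k X e = i \<longrightarrow> crossing_number c k X e \<le> m)))"

definition line_curve :: "pt \<times> pt \<Rightarrow> real \<Rightarrow> pt" where
  "line_curve L t = fst L + t *\<^sub>R snd L"

definition seg :: "(nat \<Rightarrow> pt) \<Rightarrow> nat \<times> nat \<Rightarrow> real \<Rightarrow> pt" where
  "seg p e = linepath (p (fst e)) (p (snd e))"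

definition path_meets_before :: "(real \<Rightarrow> pt) \<Rightarrow> pt set \<Rightarrow> pt set \<Rightarrow> bool" where
  "path_meets_before \<gamma> S T \<longleftrightarrow> (\<exists>s t. 0 \<le> s \<and> s < t \<and> t \<le> 1 \<and> \<gamma> s \<in> S \<and> \<gamma> t \<in> T)"

definition curve_meets_before :: "(real \<Rightarrow> pt) \<Rightarrow> pt set \<Rightarrow> pt set \<Rightarrow> bool" where
  "curve_meets_before l S T \<longleftrightarrow> (\<exists>s t. s < t \<and> l s \<in> S \<and> l t \<in> T)"

definition obj :: "(nat \<Rightarrow> pt) \<Rightarrow> (nat \<times> nat \<Rightarrow> real \<Rightarrow> pt) \<Rightarrow> nat + (nat \<times> nat) \<Rightarrow> pt set" where
  "obj pos c x = (case x of Inl v \<Rightarrow> {pos v} | Inr e \<Rightarrow> path_image (c e))"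

definition graph_objects :: "nat set \<Rightarrow> (nat \<times> nat) set \<Rightarrow> (nat + (nat \<times> nat)) set" where
  "graph_objects V E = Inl ` V \<union> Inr ` E"

text \<open>Aligned drawing (conditions (i)-(v)): straight-line drawing p of G with lines L i.
(i) a plane homeomorphism g carries the pseudoline arrangement onto the line arrangement
(inducing the cell bijection C \<mapsto> g ` C); (ii) a plane homeomorphism f carries the given
embedding onto the straight-line drawing; (iii) cell incidences; (iv) cell order along
edges; (v) incidences and order along each (pseudo)line.\<close>

definition aligned_drawing ::
  "nat set \<Rightarrow> (nat \<times> nat) set \<Rightarrow> (nat \<Rightarrow> pt) \<Rightarrow> (nat \<times> nat \<Rightarrow> real \<Rightarrow> pt) \<Rightarrow> nat \<Rightarrow> (nat \<Rightarrow> real \<Rightarrow> pt)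
     \<Rightarrow> (nat \<Rightarrow> pt) \<Rightarrow> (nat \<Rightarrow> pt \<times> pt) \<Rightarrow> bool" where
  "aligned_drawing V E pos c k X p L \<longleftrightarrow>
     plane_drawing V E p (seg p) \<and>
     (\<forall>i<k. snd (L i) \<noteq> 0) \<and>
     (\<exists>f f'. homeomorphism UNIV UNIV f f' \<and> (\<forall>v\<in>V. f (pos v) = p v) \<and>
        (\<forall>e\<in>E. f ` path_image (c e) = path_image (seg p e))) \<and>
     (\<exists>g g'. homeomorphism UNIV UNIV g g' \<and>
        (\<forall>i<k. g ` range (X i) = range (line_curve (L i))) \<and>
        (let cells = components (- (\<Union>i<k. range (X i))) in
          (\<forall>C\<in>cells. \<forall>v\<in>V. pos v \<in> C \<longleftrightarrow> p v \<in> g ` C) \<and>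
          (\<forall>C\<in>cells. \<forall>e\<in>E. path_image (c e) \<inter> C \<noteq> {} \<longleftrightarrow> path_image (seg p e) \<inter> g ` C \<noteq> {}) \<and>
          (\<forall>e\<in>E. \<forall>C\<in>cells. \<forall>C'\<in>cells.
             path_meets_before (c e) C C' \<longleftrightarrow> path_meets_before (seg p e) (g ` C) (g ` C')))) \<and>
     (\<forall>i<k. \<forall>x\<in>graph_objects V E. \<forall>y\<in>graph_objects V E.
        (range (X i) \<inter> obj pos c x \<noteq> {} \<longleftrightarrow> range (line_curve (L i)) \<inter> obj p (seg p) x \<noteq> {}) \<and>
        (curve_meets_before (X i) (obj pos c x) (obj pos c y) \<longleftrightarrow>
         curve_meets_before (line_curve (L i)) (obj p (seg p) x) (obj p (seg p) y)))"

end

theory Submission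
  imports Defs
begin

text \<open>The pseudolines are the coordinate axes, and the graph consists of four disjoint paths with two
edges, drawn as the four rotated copies of a spiral arm that winds three quarters around the origin.
Let \<open>u\<^sub>q\<close> be the middle vertex of arm \<open>q\<close>, which lies between the rays \<open>q\<close> and \<open>q + 1\<close>, and let
\<open>a\<^sub>q\<close> be its inner end on ray \<open>q - 1\<close>.  In a straight-line drawing write \<open>y\<^sub>q\<close>, \<open>x\<^sub>q\<close> for the coordinates
of \<open>u\<^sub>q\<close> along the rays \<open>q\<close>, \<open>q + 1\<close> and \<open>m\<^sub>q\<close> for the distance of \<open>a\<^sub>q\<close> from the origin.  The edge
\<open>a\<^sub>q u\<^sub>q\<close> crosses ray \<open>q\<close> beyond \<open>a\<^bsub>q+1\<^esub>\<close>, so \<open>m\<^bsub>q+1\<^esub> x\<^sub>q < m\<^sub>q y\<^sub>q\<close>.  It crosses below the outer edge of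
arm \<open>q - 1\<close>, so \<open>u\<^sub>q\<close> is trapped in the triangle which that edge cuts off from the quadrant, whence
\<open>y\<^sub>q < x\<^bsub>q-1\<^esub>\<close>.  Therefore \<open>m\<^bsub>q+1\<^esub> x\<^sub>q < m\<^sub>q x\<^bsub>q-1\<^esub>\<close> for all \<open>q\<close> modulo 4, which is absurd.\<close>

section \<open>Affine functions on the plane\<close>

definition affine_fun :: "(pt \<Rightarrow> real) \<Rightarrow> bool" where
  "affine_fun F \<longleftrightarrow> (\<forall>x y t. F ((1 - t) *\<^sub>R x + t *\<^sub>R y) = (1 - t) * F x + t * F y)"

lemma affine_funD:
  "affine_fun F \<Longrightarrow> F ((1 - t) *\<^sub>R x + t *\<^sub>R y) = (1 - t) * F x + t * F y"
  by (simp add: affine_fun_def)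

lemma affine_fun_linepath:
  "affine_fun F \<Longrightarrow> F (linepath x y t) = (1 - t) * F x + t * F y"
  by (simp add: linepath_def affine_funD)

lemma affine_fun_cmult: "affine_fun F \<Longrightarrow> affine_fun (\<lambda>x. r * F x)"
  unfolding affine_fun_def by (metis distrib_left mult.left_commute)

lemma affine_fun_uminus: "affine_fun F \<Longrightarrow> affine_fun (\<lambda>x. - F x)"
  by (simp add: affine_fun_def)

text \<open>The determinant of the vectors \<open>p - fst L\<close> and \<open>snd L\<close>; for a
  nonzero direction it gives an affine equation of the line.\<close>

definition line_fun :: "pt \<times> pt \<Rightarrow> pt \<Rightarrow> real" where
  "line_fun L p = (p $ 1 - fst L $ 1) * snd L $ 2 - (p $ 2 - fst L $ 2) * snd L $ 1"

lemma affine_line_fun: "affine_fun (line_fun L)"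
  by (simp add: affine_fun_def line_fun_def algebra_simps)

lemma continuous_on_line_fun: "continuous_on S (line_fun L)"
  unfolding line_fun_def by (intro continuous_intros)

lemma pt_eq_iff: "(x::pt) = y \<longleftrightarrow> x $ 1 = y $ 1 \<and> x $ 2 = y $ 2"
  by (simp add: vec_eq_iff forall_2)

lemma line_fun_eq_0_iff:
  assumes "snd L \<noteq> 0"
  shows "line_fun L p = 0 \<longleftrightarrow> p \<in> range (line_curve L)"
proof
  assume *: "line_fun L p = 0"
  show "p \<in> range (line_curve L)"
  proof (cases "snd L $ 1 = 0")
    case True
    then have n: "snd L $ 2 \<noteq> 0" using assms by (simp add: pt_eq_iff)
    then have "p = line_curve L ((p $ 2 - fst L $ 2) / snd L $ 2)"
      using * True by (simp add: pt_eq_iff line_curve_def line_fun_def)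
    then show ?thesis by blast
  next
    case False
    then have "p = line_curve L ((p $ 1 - fst L $ 1) / snd L $ 1)"
      using * by (simp add: pt_eq_iff line_curve_def line_fun_def field_simps)
    then show ?thesis by blast
  qed
next
  assume "p \<in> range (line_curve L)"
  then show "line_fun L p = 0" by (auto simp: line_curve_def line_fun_def)
qed

text \<open>Two lines with a single common point have independent directions: if the determinant
  \<open>d\<close> vanished, moving \<open>org\<close> by \<open>snd L\<close> would give a second
  common point. Cramer's rule then recovers a point from its two function values.\<close>

lemma line_funs_inj:
  assumes o: "range (line_curve L) \<inter> range (line_curve M) = {org}" and L: "snd L \<noteq> 0" and M: "snd M \<noteq> 0"
    and eq: "line_fun L x = line_fun L y" "line_fun M x = line_fun M y"
  shows "x = y"
proof -
  define d where "d = snd L $ 1 * snd M $ 2 - snd L $ 2 * snd M $ 1"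
  have "d \<noteq> 0"
  proof
    assume d: "d = 0"
    have org: "org \<in> range (line_curve L)" "org \<in> range (line_curve M)" using o by auto
    then obtain s t where st: "org = line_curve L s" "org = line_curve M t" by (elim rangeE)
    have "line_curve L (s + 1) = org + snd L" using st by (simp add: line_curve_def algebra_simps)
    moreover have "line_fun M (org + snd L) = line_fun M org + d"
      by (simp add: line_fun_def d_def algebra_simps)
    moreover have "line_fun M org = 0" using org line_fun_eq_0_iff[OF M] by blast
    ultimately have "line_fun M (line_curve L (s + 1)) = 0" using d by simp
    then have "line_curve L (s + 1) \<in> range (line_curve M)" using line_fun_eq_0_iff[OF M] by blast
    then have "line_curve L (s + 1) = org" using o by blast
    then show False using st L by (simp add: line_curve_def algebra_simps)
  qed
  have 1: "d * (x $ 1 - y $ 1) = 0" "d * (x $ 2 - y $ 2) = 0"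
    using eq by (simp_all add: d_def line_fun_def) algebra+
  then show ?thesis using \<open>d \<noteq> 0\<close> by (simp add: pt_eq_iff)
qed

text \<open>In the quadrant \<open>F, G > 0\<close>, the edge \<open>b u'\<close> cuts off a triangle at the origin which the
edge \<open>a u\<close> enters through the ray \<open>G = 0\<close> and cannot leave.\<close>

lemma quarter_turn:
  assumes F: "affine_fun F" and G: "affine_fun G"
    and inj: "\<And>x y. F x = F y \<Longrightarrow> G x = G y \<Longrightarrow> x = y"
    and a: "F a = 0" "G a < 0" and u: "F u > 0" "G u > 0"
    and b: "F b = 0" "G b > 0" and u': "F u' > 0" "G u' < 0"
    and c: "c \<in> closed_segment a u" "G c = 0" and c': "c' \<in> closed_segment b u'" "G c' = 0"
    and m: "0 < F m" "F m < F d" and d: "d \<in> closed_segment a u" "G d = 0" and cc': "F c < F c'"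
    and disj: "closed_segment a u \<inter> closed_segment b u' = {}"
  shows "F m * G u < - G a * F u" and "F u < F u'"
proof -
  \<comment> \<open>If \<open>x\<close> has parameter \<open>t\<close> on the segment, then
    \<open>G x = 0\<close> forces \<open>t * (G u - G a) = - G a\<close>, and
    \<open>F x = t * F u\<close> because \<open>F a = 0\<close>.\<close>
  have cross: "- G a * F u = F x * (G u - G a)" if x: "x \<in> closed_segment a u" "G x = 0" for x
  proof -
    obtain t where t: "x = (1 - t) *\<^sub>R a + t *\<^sub>R u"
      using x(1) by (auto simp: in_segment)
    have "(1 - t) * G a + t * G u = 0" and Fx: "F x = t * F u"
      using x t a by (simp_all add: affine_funD[OF F] affine_funD[OF G])
    then have "t * (G u - G a) = - G a" by (simp add: algebra_simps)
    then show ?thesis using Fx by (metis mult.assoc mult.commute)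
  qed
  \<comment> \<open>Both \<open>c\<close> and \<open>d\<close> mark the crossing of the edge with
    \<open>G = 0\<close>, so their \<open>F\<close>-values agree. They are separate because two
    comparisons along the line supply them independently.\<close>
  have "F c * (G u - G a) = F d * (G u - G a)" using cross c d by metis
  then have "F c = F d" using a u by simp
  then have m: "0 < F m" "F m < F c" using m by auto
  have "- G a * F u = F c * (G u - G a)" using cross c by blast
  moreover have "F m * (G u - G a) < F c * (G u - G a)" using m a u by simp
  moreover have "F m * G u < F m * (G u - G a)" using m a by (simp add: algebra_simps mult_pos_neg)
  ultimately show "F m * G u < - G a * F u" by simp

  obtain s where s: "0 \<le> s" "s \<le> 1" "c' = (1 - s) *\<^sub>R b + s *\<^sub>R u'"
    using c'(1) by (auto simp: in_segment)
  have Fc': "F c' = s * F u'"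
    using s b by (simp add: affine_funD[OF F])
  have "F c' \<le> F u'" using Fc' s u' by (simp add: mult_left_le_one_le)
  moreover have "F u < F c'"
  proof (rule ccontr)
    assume "\<not> F u < F c'"
    then have le: "F c' \<le> F u" by simp
    define k where "k = F c'"
    have k: "k > 0" "F c < k" using m cc' by (auto simp: k_def)
    \<comment> \<open>Intercept form, in the coordinates \<open>(F, G)\<close>, of the line through
      \<open>b = (0, G b)\<close> and \<open>c' = (k, 0)\<close>. It is negative at \<open>c\<close>
      and, if \<open>F c' \<le> F u\<close>, positive at \<open>u\<close>.\<close>
    define l where "l = (\<lambda>x. G x / G b + F x / k - 1)"
    have l: "l ((1 - r) *\<^sub>R x + r *\<^sub>R y) = (1 - r) * l x + r * l y" for r x y
      unfolding l_def affine_funD[OF F] affine_funD[OF G] add_divide_distrib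
      by (simp add: algebra_simps)
    have lc: "l c < 0" using c k by (simp add: l_def)
    have "F u / k \<ge> 1" using le k by (simp add: k_def)
    moreover have "G u / G b > 0" using u b by simp
    ultimately have lu: "l u > 0" by (simp add: l_def)
    \<comment> \<open>The parameter at which the affine function \<open>l\<close> vanishes between
      \<open>c\<close> and \<open>u\<close>.\<close>
    define r where "r = - l c / (l u - l c)"
    have r: "0 < r" "r < 1" using lc lu by (auto simp: r_def field_simps)
    define P where "P = (1 - r) *\<^sub>R c + r *\<^sub>R u"
    have "l P = (1 - r) * l c + r * l u" unfolding P_def by (rule l)
    then have "l P = 0" using lc lu by (simp add: r_def field_simps)
    have FP: "F P > 0" using m r u by (simp add: P_def affine_funD[OF F] add_pos_pos)
    have GP: "G P > 0" using c r u by (simp add: P_def affine_funD[OF G])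
    \<comment> \<open>Chosen so that the point of the segment from \<open>b\<close> to
      \<open>c'\<close> has the same \<open>F\<close>-value as \<open>P\<close>. By
      \<open>l P = 0\<close> the \<open>G\<close>-values agree too, so \<open>inj\<close> makes
      \<open>P\<close> a common point of the two edges.\<close>
    define \<tau> where "\<tau> = F P / k"
    have "G P / G b > 0" using GP b by simp
    then have "\<tau> \<le> 1" using \<open>l P = 0\<close> unfolding \<tau>_def l_def by linarith
    then have \<tau>: "0 \<le> \<tau>" "\<tau> \<le> 1" using FP k by (auto simp: \<tau>_def)
    define P' where "P' = (1 - \<tau>) *\<^sub>R b + \<tau> *\<^sub>R c'"
    have "F P' = F P" using b k by (simp add: P'_def affine_funD[OF F] \<tau>_def k_def)
    moreover have "G P' = (1 - \<tau>) * G b" unfolding P'_def affine_funD[OF G] using c' by simp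
    moreover have "G P / G b = 1 - \<tau>" using \<open>l P = 0\<close> unfolding l_def \<tau>_def by linarith
    then have "G P = (1 - \<tau>) * G b" using b by (simp add: field_simps)
    ultimately have "P = P'" using inj by metis
    have "P \<in> closed_segment c u" unfolding P_def in_segment using r by (intro exI[of _ r]) auto
    then have "P \<in> closed_segment a u" using c(1) subset_closed_segment by blast
    moreover have "P' \<in> closed_segment b c'" unfolding P'_def in_segment using \<tau> by blast
    then have "P' \<in> closed_segment b u'" using c'(1) subset_closed_segment by blast
    ultimately show False using disj \<open>P = P'\<close> by blast
  qed
  ultimately show "F u < F u'" by simp
qed

text \<open>Eliminating \<open>G u\<close> from the values at \<open>s\<close> and \<open>t\<close>
  leaves \<open>(t - s) * G a < 0\<close>. This locates the start of an edge from the order of the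
  cells that it visits.\<close>

lemma affine_start_neg:
  assumes G: "affine_fun G" and "0 \<le> s" "s < t" "G (linepath a u s) < 0" "G (linepath a u t) > 0"
  shows "G a < 0"
proof -
  have 1: "(1 - s) * G a + s * G u < 0" and 2: "(1 - t) * G a + t * G u > 0"
    using assms by (simp_all add: affine_fun_linepath)
  have "t * ((1 - s) * G a + s * G u) < 0" using 1 assms by (simp add: mult_pos_neg)
  moreover have "s * ((1 - t) * G a + t * G u) \<ge> 0" using 2 assms by simp
  ultimately have "(t - s) * G a < 0" by (simp add: algebra_simps)
  then show ?thesis using assms by (simp add: mult_less_0_iff)
qed

lemma affine_nonzero_on_segment:
  assumes F: "affine_fun F" and xy: "F x * F y > 0" and z: "z \<in> closed_segment x y"
  shows "F z \<noteq> 0"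
proof -
  obtain t where t: "0 \<le> t" "t \<le> 1" "z = (1 - t) *\<^sub>R x + t *\<^sub>R y" using z by (auto simp: in_segment)
  have "F x * F z = (1 - t) * (F x * F x) + t * (F x * F y)"
    unfolding t affine_funD[OF F] by (simp add: algebra_simps)
  moreover have "F x * F x > 0" using xy by (auto simp: zero_less_mult_iff)
  then have "(1 - t) * (F x * F x) + t * (F x * F y) > 0"
    using xy t(1,2) by (cases "t = 0") (auto intro: add_nonneg_pos)
  ultimately show ?thesis by auto
qed

text \<open>An affine function has constant slope along a line, and the reference pair
  \<open>x\<close>, \<open>y\<close> shows that this slope is positive. The parameter order in
  condition (v) thus becomes an order of coordinates, whichever way \<open>L\<close> is
  parametrized.\<close>

lemma affine_order_along_line:
  assumes F: "affine_fun F" and xy: "curve_meets_before (line_curve L) {x} {y}" "F x < F y"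
    and ST: "curve_meets_before (line_curve L) S T"
  obtains x' y' where "x' \<in> S" "x' \<in> range (line_curve L)" "y' \<in> T" "y' \<in> range (line_curve L)" "F x' < F y'"
proof -
  define k where "k = F (line_curve L 1) - F (line_curve L 0)"
  have mix: "line_curve L t = (1 - t) *\<^sub>R line_curve L 0 + t *\<^sub>R line_curve L 1" for t
    by (simp add: line_curve_def algebra_simps)
  have lin: "F (line_curve L t) = F (line_curve L 0) + t * k" for t
    unfolding k_def by (subst mix, subst affine_funD[OF F]) (simp add: algebra_simps)
  obtain s t where st: "s < t" "line_curve L s = x" "line_curve L t = y"
    using xy(1) by (auto simp: curve_meets_before_def)
  then have "0 < (t - s) * k" using xy(2) lin[of s] lin[of t] by (simp add: algebra_simps)
  then have "k > 0" using st(1) by (simp add: zero_less_mult_iff)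
  obtain s' t' where st': "s' < t'" "line_curve L s' \<in> S" "line_curve L t' \<in> T"
    using ST by (auto simp: curve_meets_before_def)
  have "F (line_curve L s') < F (line_curve L t')" using st'(1) \<open>k > 0\<close> lin[of s'] lin[of t'] by simp
  then show ?thesis using that st' by blast
qed

section \<open>The spiral drawing\<close>

text \<open>Angles are measured in quarter turns.\<close>

definition dir :: "real \<Rightarrow> pt" where
  "dir \<theta> = vector [cos (\<theta> * pi / 2), sin (\<theta> * pi / 2)]"

definition proj :: "real \<Rightarrow> pt \<Rightarrow> real" where
  "proj \<theta> p = p $ 1 * cos (\<theta> * pi / 2) + p $ 2 * sin (\<theta> * pi / 2)"

lemma dir_nth [simp]: "dir \<theta> $ 1 = cos (\<theta> * pi / 2)" "dir \<theta> $ 2 = sin (\<theta> * pi / 2)"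
  by (simp_all add: dir_def)

lemma proj_scaleR_dir: "proj \<theta> (r *\<^sub>R dir \<phi>) = r * cos ((\<phi> - \<theta>) * pi / 2)"
  by (simp add: proj_def algebra_simps cos_diff diff_divide_distrib)

lemma proj_add_2: "proj (\<theta> + 2) p = - proj \<theta> p"
  by (simp add: proj_def distrib_right add_divide_distrib cos_add sin_add)

text \<open>With angles in quarter turns, \<open>dir \<theta>\<close> and
  \<open>dir (\<theta> + 1)\<close> are orthonormal.\<close>

lemma proj_expand: "p = proj \<theta> p *\<^sub>R dir \<theta> + proj (\<theta> + 1) p *\<^sub>R dir (\<theta> + 1)"
proof -
  have 1: "cos ((\<theta> + 1) * pi / 2) = - sin (\<theta> * pi / 2)" "sin ((\<theta> + 1) * pi / 2) = cos (\<theta> * pi / 2)"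
    by (simp_all add: distrib_right add_divide_distrib cos_add sin_add)
  define C S where "C = cos (\<theta> * pi / 2)" and "S = sin (\<theta> * pi / 2)"
  have "C\<^sup>2 + S\<^sup>2 = 1" by (simp add: C_def S_def)
  then have "x = (x * C + y * S) * C - (y * C - x * S) * S" "y = (x * C + y * S) * S + (y * C - x * S) * C" for x y
    by algebra+
  then show ?thesis
    unfolding pt_eq_iff proj_def dir_nth vector_add_component vector_scaleR_component 1 C_def[symmetric] S_def[symmetric]
    by simp
qed

lemma continuous_on_proj: "continuous_on S (proj \<theta>)"
  unfolding proj_def by (intro continuous_intros)

lemma norm_dir [simp]: "norm (dir \<theta>) = 1"
  by (simp add: norm_vec_def L2_set_def sum_2)

text \<open>Arm \<open>q\<close> is an arc of an Archimedean spiral: it starts on ray \<open>q - 1\<close> at distance 1 from the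
origin, crosses rays \<open>q\<close> and \<open>q + 1\<close> at distances 2 and 3, and ends on ray \<open>q + 2\<close> at distance 4.\<close>

definition arm :: "real \<Rightarrow> real \<Rightarrow> pt" where
  "arm q \<sigma> = (2 + \<sigma>) *\<^sub>R dir (q + \<sigma>)"

lemma proj_arm: "proj q (arm q \<sigma>) = (2 + \<sigma>) * cos (\<sigma> * pi / 2)"
  by (simp add: arm_def proj_scaleR_dir)

lemma proj_arm_Suc: "proj (q + 1) (arm q \<sigma>) = (2 + \<sigma>) * sin (\<sigma> * pi / 2)"
  by (simp add: arm_def proj_scaleR_dir left_diff_distrib diff_divide_distrib cos_diff)

lemma norm_arm: "\<sigma> \<in> {-1..2} \<Longrightarrow> norm (arm q \<sigma>) = 2 + \<sigma>"
  by (simp add: arm_def)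

lemma dir_eq_dirD:
  assumes "dir x = dir y" shows "\<exists>n::int. x - y = 4 * of_int n"
proof -
  have "sin (x * pi / 2) = sin (y * pi / 2) \<and> cos (x * pi / 2) = cos (y * pi / 2)"
    using assms by (simp add: pt_eq_iff)
  then obtain n :: int where "x * pi / 2 = y * pi / 2 + 2 * pi * of_int n"
    using sin_cos_eq_iff by blast
  then have "pi * (x - y) = pi * (4 * of_int n)" by (simp add: algebra_simps)
  then have "x - y = 4 * of_int n" by simp
  then show ?thesis ..
qed

text \<open>The norm \<open>2 + \<sigma>\<close> determines the parameter. Then the two directions
  differ by whole turns, that is by multiples of 4, and indices below 4 must agree.\<close>

lemma arm_inj:
  assumes "arm (real q) \<sigma> = arm (real q') \<sigma>'" "\<sigma> \<in> {-1..2}" "\<sigma>' \<in> {-1..2}" "q < 4" "q' < 4"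
  shows "q = q'" "\<sigma> = \<sigma>'"
proof -
  show \<sigma>: "\<sigma> = \<sigma>'" using assms norm_arm by (metis add_left_cancel)
  then have "dir (real q + \<sigma>) = dir (real q' + \<sigma>)"
    using assms by (simp add: arm_def)
  then obtain n :: int where "real q - real q' = 4 * of_int n"
    using dir_eq_dirD[of "real q + \<sigma>" "real q' + \<sigma>"] by auto
  then have "of_int (int q - int q') = (of_int (4 * n) :: real)" by simp
  then have "int q - int q' = 4 * n" using of_int_eq_iff by blast
  then show "q = q'" using assms by presburger
qed

lemma continuous_on_arm: "continuous_on S (arm q)"
proof -
  \<comment> \<open>Constant basis vectors replace \<open>vector\<close> with variable entries, so
    that the continuity rules apply.\<close>
  have "dir \<theta> = cos (\<theta> * pi / 2) *\<^sub>R vector [1, 0] + sin (\<theta> * pi / 2) *\<^sub>R vector [0, 1]" for \<theta>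
    by (simp add: pt_eq_iff)
  then have "arm q = (\<lambda>\<sigma>. (2 + \<sigma>) *\<^sub>R (cos ((q + \<sigma>) * pi / 2) *\<^sub>R vector [1, 0]
      + sin ((q + \<sigma>) * pi / 2) *\<^sub>R vector [0, 1]))"
    by (simp add: arm_def fun_eq_iff)
  moreover have "continuous_on S (\<lambda>\<sigma>. (2 + \<sigma>) *\<^sub>R (cos ((q + \<sigma>) * pi / 2) *\<^sub>R (vector [1, 0] :: pt)
      + sin ((q + \<sigma>) * pi / 2) *\<^sub>R vector [0, 1]))"
    by (intro continuous_intros) auto
  ultimately show ?thesis by simp
qed

section \<open>The coordinate axes and where the arms meet them\<close>

definition spoke_axis :: "nat \<Rightarrow> real \<Rightarrow> pt" where
  "spoke_axis i t = t *\<^sub>R dir (real i)"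

lemma range_spoke_axis: "range (spoke_axis i) = {p. proj (real i + 1) p = 0}"
proof safe
  fix t show "proj (real i + 1) (spoke_axis i t) = 0"
    by (simp add: spoke_axis_def proj_scaleR_dir)
next
  fix p assume "proj (real i + 1) p = 0"
  then have "p = spoke_axis i (proj i p)" using proj_expand[of p "real i"] by (simp add: spoke_axis_def)
  then show "p \<in> range (spoke_axis i)" by blast
qed

text \<open>A half turn only changes the sign of \<open>proj\<close>, so the axis that carries ray
  \<open>q\<close> depends on the parity of \<open>q\<close> alone; hence the induction in steps of
  two.\<close>

lemma range_spoke_axis_mod_2: "range (spoke_axis (q mod 2)) = {p. proj (real q + 1) p = 0}"
proof (induction q rule: nat_induct2)
  case 0 show ?case by (simp add: range_spoke_axis)
next
  case 1 show ?case by (simp add: range_spoke_axis)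
next
  case (step q)
  have "proj (real (q + 2) + 1) p = - proj (real q + 1) p" for p
    using proj_add_2[of "real q + 1" p] by (simp add: add_ac)
  then show ?case using step by simp
qed

lemma range_spoke_axis_other:
  assumes "i < 2" "i \<noteq> q mod 2" shows "range (spoke_axis i) = {p. proj (real q) p = 0}"
proof -
  have "i = Suc q mod 2" using assms by presburger
  moreover have "proj (real (Suc q) + 1) p = - proj q p" for p
    using proj_add_2[of q p] by (simp add: add_ac)
  ultimately show ?thesis by (simp only: range_spoke_axis_mod_2) simp
qed

lemma sin_half_pi_pos: "0 < \<sigma> \<Longrightarrow> \<sigma> < 2 \<Longrightarrow> 0 < sin (\<sigma> * pi / 2)"
  using mult_strict_right_mono[of \<sigma> 2 pi] by (intro sin_gt_zero) auto

lemma sin_half_pi_neg: "-2 < \<sigma> \<Longrightarrow> \<sigma> < 0 \<Longrightarrow> sin (\<sigma> * pi / 2) < 0"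
  using sin_half_pi_pos[of "- \<sigma>"] by simp

lemma cos_half_pi_pos: "-1 < \<sigma> \<Longrightarrow> \<sigma> < 1 \<Longrightarrow> 0 < cos (\<sigma> * pi / 2)"
  using sin_half_pi_pos[of "\<sigma> + 1"] by (simp add: distrib_right add_divide_distrib sin_add)

lemma cos_half_pi_neg: "1 < \<sigma> \<Longrightarrow> \<sigma> < 3 \<Longrightarrow> cos (\<sigma> * pi / 2) < 0"
  using cos_half_pi_pos[of "\<sigma> - 2"] by (simp add: left_diff_distrib diff_divide_distrib cos_diff)

lemma sin_half_pi_eq_0_iff:
  assumes "\<sigma> \<in> {-1..2}" shows "sin (\<sigma> * pi / 2) = 0 \<longleftrightarrow> \<sigma> = 0 \<or> \<sigma> = 2"
  using assms sin_half_pi_pos[of \<sigma>] sin_half_pi_neg[of \<sigma>] by fastforce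

lemma cos_half_pi_eq_0_iff:
  assumes "\<sigma> \<in> {-1..2}" shows "cos (\<sigma> * pi / 2) = 0 \<longleftrightarrow> \<sigma> = -1 \<or> \<sigma> = 1"
  using assms cos_half_pi_pos[of \<sigma>] cos_half_pi_neg[of \<sigma>] by fastforce

text \<open>The radius \<open>2 + \<sigma>\<close> is positive, so only the zeros of sine and cosine
  matter: the sine belongs to the axis of ray \<open>q\<close>, the cosine to the perpendicular
  one.\<close>

lemma arm_on_axis_iff:
  assumes "\<sigma> \<in> {-1..2}" "i < 2"
  shows "arm (real q) \<sigma> \<in> range (spoke_axis i) \<longleftrightarrow>
    (if i = q mod 2 then \<sigma> = 0 \<or> \<sigma> = 2 else \<sigma> = -1 \<or> \<sigma> = 1)"
proof (cases "i = q mod 2")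
  case True
  then show ?thesis
    using assms sin_half_pi_eq_0_iff[of \<sigma>] by (simp add: range_spoke_axis_mod_2 proj_arm_Suc)
next
  case False
  then show ?thesis
    using assms cos_half_pi_eq_0_iff[of \<sigma>] by (simp add: range_spoke_axis_other proj_arm)
qed

text \<open>Vertices \<open>q\<close>, \<open>4 + q\<close> and \<open>8 + q\<close> (for \<open>q < 4\<close>) are the inner end, the outer end and the
midpoint of arm \<open>q\<close>; the two edges \<open>(q, 8 + q)\<close> and \<open>(4 + q, 8 + q)\<close> are its halves.\<close>

definition knot :: "nat \<Rightarrow> real" where
  "knot v = (if v < 4 then -1 else if v < 8 then 2 else 1 / 2)"

definition wheel_V :: "nat set" where "wheel_V = {..<12}"

definition wheel_E :: "(nat \<times> nat) set" where "wheel_E = {(z, 8 + z mod 4) | z. z < 8}"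

definition wheel_pos :: "nat \<Rightarrow> pt" where "wheel_pos v = arm (real (v mod 4)) (knot v)"

text \<open>\<open>fst e mod 4\<close> recovers the arm. Both halves run towards the midpoint
  vertex, the inner one with growing and the outer one with falling \<open>\<sigma>\<close>.\<close>

definition wheel_edge :: "nat \<times> nat \<Rightarrow> real \<Rightarrow> pt" where
  "wheel_edge e t = arm (real (fst e mod 4)) (linepath (knot (fst e)) (knot (snd e)) t)"

lemma knot_bounds: "knot v \<in> {-1..2}"
  by (simp add: knot_def)

lemma linepath_knot_bounds: "t \<in> {0..1} \<Longrightarrow> linepath (knot v) (knot w) t \<in> {-1..2}"
  by (metis convex_contains_segment convex_real_interval(5) knot_bounds linepath_in_path
      subsetD)

lemma wheel_E_cases:
  assumes "e \<in> wheel_E"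
  obtains (inner) q where "q < 4" "e = (q, 8 + q)" | (outer) q where "q < 4" "e = (4 + q, 8 + q)"
proof -
  obtain z where z: "z < 8" "e = (z, 8 + z mod 4)" using assms by (auto simp: wheel_E_def)
  show ?thesis
  proof (cases "z < 4")
    case True then show ?thesis using z inner by simp
  next
    case False
    then have "z mod 4 = z - 4" using z by (simp add: mod_if)
    then show ?thesis using False z outer[of "z - 4"] by simp
  qed
qed

section \<open>Parametrization of the edges and planarity of the drawing\<close>

lemma inner_edge: "q < 4 \<Longrightarrow> wheel_edge (q, 8 + q) t = arm (real q) (-1 + 3 / 2 * t)"
  by (simp add: wheel_edge_def knot_def linepath_def)

lemma outer_edge: "q < 4 \<Longrightarrow> wheel_edge (4 + q, 8 + q) t = arm (real q) (2 - 3 / 2 * t)"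
  by (simp add: wheel_edge_def knot_def linepath_def)

lemma image_inner: "q < 4 \<Longrightarrow> path_image (wheel_edge (q, 8 + q)) = arm (real q) ` {-1..1/2}"
proof -
  assume q: "q < 4"
  have "(\<lambda>t. -1 + 3 / 2 * t) ` {0..1} = {-1..1/2 :: real}"
    using image_affinity_atLeastAtMost[of "3/2" "-1" 0 "1::real"] by (simp add: add.commute)
  moreover have "path_image (wheel_edge (q, 8 + q)) = arm (real q) ` (\<lambda>t. -1 + 3 / 2 * t) ` {0..1}"
    using q by (simp add: path_image_def inner_edge image_image)
  ultimately show ?thesis by simp
qed

lemma image_outer: "q < 4 \<Longrightarrow> path_image (wheel_edge (4 + q, 8 + q)) = arm (real q) ` {1/2..2}"
proof -
  assume q: "q < 4"
  have "(\<lambda>t. 2 - 3 / 2 * t) ` {0..1} = {1/2..2 :: real}"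
    using image_affinity_atLeastAtMost[of "-3/2" 2 0 "1::real"] by (simp add: add.commute)
  moreover have "path_image (wheel_edge (4 + q, 8 + q)) = arm (real q) ` (\<lambda>t. 2 - 3 / 2 * t) ` {0..1}"
    using q by (simp add: path_image_def outer_edge image_image)
  ultimately show ?thesis by simp
qed

lemma mod_4_add_8: "(8 + n) mod 4 = n mod (4::nat)"
  by presburger

lemma wheel_pos_simps:
  "q < 4 \<Longrightarrow> wheel_pos q = arm (real q) (-1)"
  "q < 4 \<Longrightarrow> wheel_pos (4 + q) = arm (real q) 2"
  "q < 4 \<Longrightarrow> wheel_pos (8 + q) = arm (real q) (1/2)"
  by (simp_all add: wheel_pos_def knot_def mod_4_add_8)

text \<open>Everything reduces to \<open>arm_inj\<close>: distinct arms are disjoint, and the two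
  halves of one arm cover the parameters up to 1/2 and from 1/2 on, where the midpoint vertex
  sits.\<close>

lemma wheel_plane_drawing: "plane_drawing wheel_V wheel_E wheel_pos wheel_edge"
  unfolding plane_drawing_def
proof (intro conjI ballI impI)
  show "finite wheel_V" by (simp add: wheel_V_def)
  show "wheel_E \<subseteq> wheel_V \<times> wheel_V" by (auto simp: wheel_V_def wheel_E_def)
  show "case e of (u, v) \<Rightarrow> u \<noteq> v \<and> (v, u) \<notin> wheel_E" if "e \<in> wheel_E" for e
    using that by (auto simp: wheel_E_def)
  show "inj_on wheel_pos wheel_V"
  proof (rule inj_onI)
    fix v w assume vw: "v \<in> wheel_V" "w \<in> wheel_V" "wheel_pos v = wheel_pos w"
    then have "v mod 4 = w mod 4" "knot v = knot w"
      using arm_inj[of "v mod 4" "knot v" "w mod 4" "knot w"] knot_bounds by (auto simp: wheel_pos_def)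
    \<comment> \<open>The quotient by 4 tells inner ends, outer ends and midpoints apart, just as
      \<open>knot\<close> does; together with the residue it determines the vertex.\<close>
    moreover have "x div 4 = (if x < 4 then 0 else if x < 8 then 1 else 2)" if "x < 12" for x :: nat
      using that by (auto intro: div_nat_eqI)
    then have "v div 4 = w div 4"
      using vw(1,2) \<open>knot v = knot w\<close> by (auto simp: knot_def wheel_V_def split: if_splits)
    ultimately show "v = w" by (metis div_mult_mod_eq)
  qed
  fix e assume e: "e \<in> wheel_E"
  show "arc (wheel_edge e)"
  proof -
    have "continuous_on {0..1} (wheel_edge e)"
      unfolding wheel_edge_def
      by (rule continuous_on_compose2[OF continuous_on_arm[of UNIV]]) (auto intro: continuous_on_linepath)
    moreover have "inj_on (wheel_edge e) {0..1}"
    proof (rule inj_onI)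
      fix s t :: real assume st: "s \<in> {0..1}" "t \<in> {0..1}" "wheel_edge e s = wheel_edge e t"
      have "linepath (knot (fst e)) (knot (snd e)) s = linepath (knot (fst e)) (knot (snd e)) t"
        using arm_inj(2) st linepath_knot_bounds by (simp add: wheel_edge_def)
      moreover have "knot (fst e) \<noteq> knot (snd e)" using e by (auto simp: wheel_E_def knot_def)
      ultimately show "s = t" using inj_on_linepath st by (metis inj_onD)
    qed
    ultimately show ?thesis by (simp add: arc_def path_def)
  qed
  show "pathstart (wheel_edge e) = wheel_pos (fst e)"
    by (simp add: pathstart_def wheel_edge_def wheel_pos_def linepath_0')
  show "pathfinish (wheel_edge e) = wheel_pos (snd e)"
    using e by (auto simp: pathfinish_def wheel_edge_def wheel_pos_def linepath_1' wheel_E_def mod_4_add_8)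
  show "wheel_pos w \<notin> wheel_edge e ` {0<..<1}" if "w \<in> wheel_V" for w
  proof
    assume "wheel_pos w \<in> wheel_edge e ` {0<..<1}"
    then obtain t where t: "0 < t" "t < 1" "wheel_pos w = wheel_edge e t" by auto
    then have k: "knot w = linepath (knot (fst e)) (knot (snd e)) t"
      using arm_inj(2)[of "w mod 4" "knot w" "fst e mod 4" "linepath (knot (fst e)) (knot (snd e)) t"]
        knot_bounds linepath_knot_bounds by (simp add: wheel_pos_def wheel_edge_def)
    from e show False
    proof (cases rule: wheel_E_cases)
      case (inner q)
      then have "knot w = -1 + 3 / 2 * t" using k by (simp add: knot_def linepath_def)
      then show False using t by (auto simp: knot_def split: if_splits)
    next
      case (outer q)
      then have "knot w = 2 - 3 / 2 * t" using k by (simp add: knot_def linepath_def)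
      then show False using t by (auto simp: knot_def split: if_splits)
    qed
  qed
  show "path_image (wheel_edge e) \<inter> path_image (wheel_edge e')
      \<subseteq> wheel_pos ` ({fst e, snd e} \<inter> {fst e', snd e'})" if e': "e' \<in> wheel_E" and ne: "e \<noteq> e'" for e'
  proof
    fix x assume x: "x \<in> path_image (wheel_edge e) \<inter> path_image (wheel_edge e')"
    have tip: "x \<in> wheel_pos ` {8 + q}"
      if "q < 4" "q' < 4" "x \<in> arm (real q) ` {-1..1/2}" "x \<in> arm (real q') ` {1/2..2}" "q = q'" for q q'
    proof -
      obtain \<sigma> \<sigma>' where s: "x = arm (real q) \<sigma>" "\<sigma> \<in> {-1..1/2}" "x = arm (real q') \<sigma>'" "\<sigma>' \<in> {1/2..2}"
        using \<open>x \<in> arm (real q) ` _\<close> \<open>x \<in> arm (real q') ` _\<close> by blast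
      have "\<sigma> = \<sigma>'"
        by (rule arm_inj(2)[of q \<sigma> q' \<sigma>']) (use s(2,4) \<open>q < 4\<close> \<open>q' < 4\<close> in \<open>auto simp flip: s(1,3)\<close>)
      then have "\<sigma> = 1/2" using s(2,4) by simp
      then have "x = wheel_pos (8 + q)" using s(1) \<open>q < 4\<close> by (simp only: wheel_pos_simps)
      then show ?thesis by simp
    qed
    have same: "q = q'" if "q < 4" "q' < 4" "x \<in> arm (real q) ` S" "x \<in> arm (real q') ` T"
        "S \<subseteq> {-1..2}" "T \<subseteq> {-1..2}" for q q' S T
      using that arm_inj(1) by blast
    have sub: "{-1..1/2} \<subseteq> {-1..2::real}" "{1/2..2} \<subseteq> {-1..2::real}" by auto
    from e show "x \<in> wheel_pos ` ({fst e, snd e} \<inter> {fst e', snd e'})"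
    proof (cases rule: wheel_E_cases)
      case inner: (inner q)
      from e' show ?thesis
      proof (cases rule: wheel_E_cases)
        case (inner q')
        then show ?thesis using x ne \<open>e = _\<close> \<open>q < 4\<close> same[of q q' "{-1..1/2}" "{-1..1/2}"] sub by (simp add: image_inner)
      next
        case (outer q')
        then have "q = q'" using x inner same[of q q' "{-1..1/2}" "{1/2..2}"] sub by (simp add: image_inner image_outer)
        then show ?thesis using x inner outer tip[of q q'] by (simp add: image_inner image_outer)
      qed
    next
      case outer: (outer q)
      from e' show ?thesis
      proof (cases rule: wheel_E_cases)
        case (outer q')
        then show ?thesis using x ne \<open>e = _\<close> \<open>q < 4\<close> same[of q q' "{1/2..2}" "{1/2..2}"] sub by (simp add: image_outer)
      next
        case (inner q')
        then have "q' = q" using x outer same[of q' q "{-1..1/2}" "{1/2..2}"] sub by (simp add: image_inner image_outer)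
        then show ?thesis using x inner outer tip[of q' q] by (simp add: image_inner image_outer)
      qed
    qed
  qed
qed

section \<open>Crossings as sign changes, and the axes as pseudolines\<close>

lemma connected_nonzero_same_sign:
  fixes \<phi> :: "'a::topological_space \<Rightarrow> real"
  assumes "connected S" "continuous_on S \<phi>" "\<And>x. x \<in> S \<Longrightarrow> \<phi> x \<noteq> 0" "x \<in> S" "y \<in> S"
  shows "\<phi> x * \<phi> y > 0"
proof (rule ccontr)
  assume "\<not> \<phi> x * \<phi> y > 0"
  then have "\<phi> x \<le> 0 \<and> 0 \<le> \<phi> y \<or> \<phi> y \<le> 0 \<and> 0 \<le> \<phi> x" by (simp add: mult_le_0_iff not_less) linarith
  moreover have "connected (\<phi> ` S)" using assms connected_continuous_image by blast
  ultimately have "0 \<in> \<phi> ` S"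
    using assms(4,5) by (metis connectedD_interval imageI)
  then show False using assms(3) by auto
qed

text \<open>A connected set that avoids the zeros of a continuous \<open>\<phi>\<close> sees only
  one sign of it, so a sign change along \<open>\<gamma>\<close> puts the two points into different
  components of the complement.\<close>

lemma crosses_atI:
  fixes \<phi> :: "pt \<Rightarrow> real"
  assumes l: "range l = {p. \<phi> p = 0}" and \<phi>: "continuous_on UNIV \<phi>" and "\<epsilon> > 0"
    and opp: "\<And>a b. t - \<epsilon> < a \<Longrightarrow> a < t \<Longrightarrow> t < b \<Longrightarrow> b < t + \<epsilon> \<Longrightarrow> \<phi> (\<gamma> a) * \<phi> (\<gamma> b) < 0"
  shows "crosses_at l \<gamma> t"
  unfolding crosses_at_def
proof (intro exI[of _ \<epsilon>] conjI allI impI)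
  fix a b assume ab: "t - \<epsilon> < a \<and> a < t \<and> t < b \<and> b < t + \<epsilon>"
  then have neg: "\<phi> (\<gamma> a) * \<phi> (\<gamma> b) < 0" using opp by blast
  then show "\<gamma> a \<notin> range l" "\<gamma> b \<notin> range l" unfolding l by auto
  show "\<not> connected_component (- range l) (\<gamma> a) (\<gamma> b)"
  proof
    assume "connected_component (- range l) (\<gamma> a) (\<gamma> b)"
    then obtain S where "connected S" "S \<subseteq> - range l" "\<gamma> a \<in> S" "\<gamma> b \<in> S"
      by (auto simp: connected_component_def)
    then have "\<phi> (\<gamma> a) * \<phi> (\<gamma> b) > 0"
      using continuous_on_subset[OF \<phi>] by (intro connected_nonzero_same_sign[of S]) (auto simp: l)
    then show False using neg by simp
  qed
qed fact

lemma wheel_drawing_bounded: "drawing_set wheel_V wheel_E wheel_pos wheel_edge \<subseteq> cball 0 4"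
proof -
  have "norm (arm q \<sigma>) \<le> 4" if "\<sigma> \<in> {-1..2}" for q \<sigma> using that by (simp add: norm_arm)
  then show ?thesis
    using knot_bounds linepath_knot_bounds
    by (auto simp: drawing_set_def wheel_pos_def path_image_def wheel_edge_def)
qed

text \<open>\<open>outside\<close> is antitone, and the outside of the ball of radius 4 is its
  complement.\<close>

lemma spoke_axis_outside:
  "\<bar>t\<bar> > 4 \<Longrightarrow> spoke_axis i t \<in> outside (drawing_set wheel_V wheel_E wheel_pos wheel_edge)"
  using outside_mono[OF wheel_drawing_bounded] outside_convex[of "cball (0::pt) 4"]
  by (auto simp: spoke_axis_def)

text \<open>Each half arm meets each axis exactly once. The inner half starts on the axis
  perpendicular to ray \<open>q\<close> and crosses that of ray \<open>q\<close> at
  \<open>\<sigma> = 0\<close>; the outer half starts on the axis of ray \<open>q\<close> and crosses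
  the perpendicular one at \<open>\<sigma> = 1\<close>.\<close>

lemma wheel_pseudoline:
  assumes i: "i < 2" shows "pseudoline wheel_V wheel_E wheel_pos wheel_edge (spoke_axis i)"
  unfolding pseudoline_def
proof (intro conjI ballI)
  show "continuous_on UNIV (spoke_axis i)" unfolding spoke_axis_def by (intro continuous_intros)
  have "dir (real i) \<noteq> 0" using norm_dir by (metis norm_zero zero_neq_one)
  then show "inj (spoke_axis i)" by (auto simp: inj_def spoke_axis_def)
  have norm: "norm (spoke_axis i t) = \<bar>t\<bar>" for t by (simp add: spoke_axis_def)
  show "filterlim (\<lambda>t. norm (spoke_axis i t)) at_top at_top"
    unfolding norm by (rule filterlim_abs_real)
  show "filterlim (\<lambda>t. norm (spoke_axis i t)) at_top at_bot"
    unfolding norm by (simp add: filterlim_at_bot_mirror filterlim_abs_real)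
  show "\<forall>\<^sub>F t in at_top. spoke_axis i t \<in> outside (drawing_set wheel_V wheel_E wheel_pos wheel_edge)"
    using eventually_gt_at_top[of 4] by eventually_elim (simp add: spoke_axis_outside)
  show "\<forall>\<^sub>F t in at_bot. spoke_axis i t \<in> outside (drawing_set wheel_V wheel_E wheel_pos wheel_edge)"
    using eventually_gt_at_bot[of "-4"] by eventually_elim (simp add: spoke_axis_outside)
  fix e assume e: "e \<in> wheel_E"
  have "(\<forall>p q. p \<in> path_image (wheel_edge e) \<inter> range (spoke_axis i) \<and>
           q \<in> path_image (wheel_edge e) \<inter> range (spoke_axis i) \<longrightarrow> p = q) \<and>
        (\<forall>t\<in>{0<..<1}. wheel_edge e t \<in> range (spoke_axis i) \<longrightarrow> crosses_at (spoke_axis i) (wheel_edge e) t)"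
    using e
  proof (cases rule: wheel_E_cases)
    case (inner q)
    have C: "crosses_at (spoke_axis i) (wheel_edge e) t"
      if t: "0 < t" "t < 1" "wheel_edge e t \<in> range (spoke_axis i)" for t
    proof -
      \<comment> \<open>The value 2/3 solves \<open>-1 + 3 / 2 * t = 0\<close>. The radius 1/3 below
        keeps \<open>a\<close> and \<open>b\<close> in the open unit interval, where the sine has no
        further zero.\<close>
      have *: "i = q mod 2" "t = 2 / 3"
        using t inner arm_on_axis_iff[of "-1 + 3 / 2 * t" i q] i by (auto simp: inner_edge split: if_splits)
      show ?thesis
      proof (rule crosses_atI)
        show "range (spoke_axis i) = {p. proj (real q + 1) p = 0}" unfolding * by (rule range_spoke_axis_mod_2)
        show "(1/3::real) > 0" by simp
        fix a b assume "t - 1/3 < a" "a < t" "t < b" "b < t + 1/3"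
        then show "proj (real q + 1) (wheel_edge e a) * proj (real q + 1) (wheel_edge e b) < 0"
          using inner * sin_half_pi_neg[of "-1 + 3 / 2 * a"] sin_half_pi_pos[of "-1 + 3 / 2 * b"]
          by (simp add: inner_edge proj_arm_Suc mult_less_0_iff zero_less_mult_iff)
      qed (rule continuous_on_proj)
    qed
    have U: "p = arm (real q) (if i = q mod 2 then 0 else -1)"
      if p: "p \<in> path_image (wheel_edge e) \<inter> range (spoke_axis i)" for p
    proof -
      obtain \<sigma> where \<sigma>: "p = arm (real q) \<sigma>" "\<sigma> \<in> {-1..1/2}" using p inner unfolding image_inner[OF \<open>q < 4\<close>] \<open>e = _\<close> by blast
      moreover have "arm (real q) \<sigma> \<in> range (spoke_axis i)" using p unfolding \<sigma>(1) by (rule IntD2)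
      ultimately show ?thesis using arm_on_axis_iff[of \<sigma> i q] i by (auto simp del: range_eqI)
    qed
    show ?thesis
    proof (intro conjI allI impI ballI)
      fix x y assume "x \<in> path_image (wheel_edge e) \<inter> range (spoke_axis i) \<and>
        y \<in> path_image (wheel_edge e) \<inter> range (spoke_axis i)"
      then show "x = y" using U[of x] U[of y] by simp
    qed (use C in simp)
  next
    case (outer q)
    have C: "crosses_at (spoke_axis i) (wheel_edge e) t"
      if t: "0 < t" "t < 1" "wheel_edge e t \<in> range (spoke_axis i)" for t
    proof -
      \<comment> \<open>Here 2/3 solves \<open>2 - 3 / 2 * t = 1\<close>, the only zero of the
        cosine inside the outer half.\<close>
      have *: "i \<noteq> q mod 2" "t = 2 / 3"
        using t outer arm_on_axis_iff[of "2 - 3 / 2 * t" i q] i by (auto simp: outer_edge split: if_splits)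
      show ?thesis
      proof (rule crosses_atI)
        show "range (spoke_axis i) = {p. proj (real q) p = 0}" using i * by (simp add: range_spoke_axis_other)
        show "(1/3::real) > 0" by simp
        fix a b assume "t - 1/3 < a" "a < t" "t < b" "b < t + 1/3"
        then show "proj (real q) (wheel_edge e a) * proj (real q) (wheel_edge e b) < 0"
          using outer * cos_half_pi_neg[of "2 - 3 / 2 * a"] cos_half_pi_pos[of "2 - 3 / 2 * b"]
          by (simp add: outer_edge proj_arm mult_less_0_iff zero_less_mult_iff)
      qed (rule continuous_on_proj)
    qed
    have U: "p = arm (real q) (if i = q mod 2 then 2 else 1)"
      if p: "p \<in> path_image (wheel_edge e) \<inter> range (spoke_axis i)" for p
    proof -
      obtain \<sigma> where \<sigma>: "p = arm (real q) \<sigma>" "\<sigma> \<in> {1/2..2}" using p outer unfolding image_outer[OF \<open>q < 4\<close>] \<open>e = _\<close> by blast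
      moreover have "arm (real q) \<sigma> \<in> range (spoke_axis i)" using p unfolding \<sigma>(1) by (rule IntD2)
      ultimately show ?thesis using arm_on_axis_iff[of \<sigma> i q] i by (auto simp del: range_eqI)
    qed
    show ?thesis
    proof (intro conjI allI impI ballI)
      fix x y assume "x \<in> path_image (wheel_edge e) \<inter> range (spoke_axis i) \<and>
        y \<in> path_image (wheel_edge e) \<inter> range (spoke_axis i)"
      then show "x = y" using U[of x] U[of y] by simp
    qed (use C in simp)
  qed
  then show "path_image (wheel_edge e) \<subseteq> range (spoke_axis i) \<or>
     (\<forall>p q. p \<in> path_image (wheel_edge e) \<inter> range (spoke_axis i) \<and>
         q \<in> path_image (wheel_edge e) \<inter> range (spoke_axis i) \<longrightarrow> p = q) \<and>
     (\<forall>t\<in>{0<..<1}. wheel_edge e t \<in> range (spoke_axis i) \<longrightarrow> crosses_at (spoke_axis i) (wheel_edge e) t)" ..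
qed

lemma spoke_axes_Int: "range (spoke_axis 0) \<inter> range (spoke_axis 1) = {0}"
proof -
  have "p = 0" if "proj 1 p = 0" "proj 2 p = 0" for p
    using that proj_expand[of p 1] by simp
  then show ?thesis by (auto simp: range_spoke_axis) (simp_all add: proj_def)
qed

lemma wheel_star_aligned: "star_aligned_graph wheel_V wheel_E wheel_pos wheel_edge 2 spoke_axis"
  unfolding star_aligned_graph_def aligned_graph_def
proof (intro conjI allI impI exI[of _ 0])
  fix i j :: nat assume ij: "i < 2" "j < 2" "i \<noteq> j"
  show Int: "range (spoke_axis i) \<inter> range (spoke_axis j) = {0}"
    using ij spoke_axes_Int by (auto simp: less_2_cases_iff)
  show "p = q" if "p \<in> range (spoke_axis i) \<inter> range (spoke_axis j) \<and> q \<in> range (spoke_axis i) \<inter> range (spoke_axis j)" for p q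
    using that unfolding Int by simp
  fix s assume "spoke_axis j s \<in> range (spoke_axis i)"
  then have "spoke_axis j s = 0" using Int by blast
  then have "norm (spoke_axis j s) = 0" by simp
  then have s: "s = 0" by (simp add: spoke_axis_def)
  \<comment> \<open>The angle between axis \<open>j\<close> and the normal of axis \<open>i\<close>
    is 0 or a half turn, so the product of the two projections below equals
    \<open>a * b\<close>.\<close>
  have "(real j - (real i + 1)) * pi / 2 = 0 \<or> (real j - (real i + 1)) * pi / 2 = - pi"
    using ij by (auto simp: less_2_cases_iff)
  then have c: "(cos ((real j - (real i + 1)) * pi / 2))\<^sup>2 = 1" by auto
  show "crosses_at (spoke_axis i) (spoke_axis j) s"
  proof (rule crosses_atI[OF range_spoke_axis continuous_on_proj zero_less_one])
    fix a b assume ab: "s - 1 < a" "a < s" "s < b" "b < s + 1"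
    have "proj (real i + 1) (spoke_axis j a) * proj (real i + 1) (spoke_axis j b)
      = a * b * (cos ((real j - (real i + 1)) * pi / 2))\<^sup>2"
      by (simp add: spoke_axis_def proj_scaleR_dir power2_eq_square)
    then show "proj (real i + 1) (spoke_axis j a) * proj (real i + 1) (spoke_axis j b) < 0"
      using ab s by (simp add: c mult_neg_pos)
  qed
qed (use wheel_plane_drawing wheel_pseudoline in auto)

section \<open>Anchoring and crossing numbers of the edges\<close>

lemma wheel_tip_off: "q < 4 \<Longrightarrow> \<not> on_pl 2 spoke_axis (wheel_pos (8 + q))"
  using arm_on_axis_iff[of "1/2" _ q] by (auto simp: on_pl_def wheel_pos_simps split: if_splits)

lemma wheel_anchor_on:
  assumes "z < 8" shows "on_pl 2 spoke_axis (wheel_pos z)"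
proof -
  define j where "j = z mod 4 mod 2"
  \<comment> \<open>Inner ends, at \<open>\<sigma> = -1\<close>, lie on the axis perpendicular to
    the ray of their arm; outer ends, at \<open>\<sigma> = 2\<close>, lie on the axis of that
    ray.\<close>
  define i where "i = (if z < 4 then 1 - j else j)"
  have "j < 2" by (simp add: j_def)
  then have "i < 2" and "z < 4 \<Longrightarrow> i \<noteq> j" unfolding i_def by (auto simp: less_2_cases_iff)
  then have "wheel_pos z \<in> range (spoke_axis i)"
    unfolding wheel_pos_def arm_on_axis_iff[OF knot_bounds \<open>i < 2\<close>] j_def[symmetric]
    using assms by (simp add: knot_def i_def)
  then show ?thesis using \<open>i < 2\<close> unfolding on_pl_def by blast
qed

text \<open>Every edge ends in a midpoint vertex, which lies off both axes; this excludes the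
  anchoring value 2.\<close>

lemma wheel_anchored_once:
  assumes "e \<in> wheel_E"
  shows "on_pl 2 spoke_axis (wheel_pos (fst e))" "\<not> on_pl 2 spoke_axis (wheel_pos (snd e))"
    "anchoring wheel_pos 2 spoke_axis e = 1"
proof -
  show 1: "on_pl 2 spoke_axis (wheel_pos (fst e))" "\<not> on_pl 2 spoke_axis (wheel_pos (snd e))"
    using assms wheel_tip_off wheel_anchor_on by (auto simp: wheel_E_def)
  then show "anchoring wheel_pos 2 spoke_axis e = 1" by (auto simp: anchoring_def on_pl_def)
qed

text \<open>Only one axis meets the open half arm: that of ray \<open>q\<close> for the inner half,
  the perpendicular one for the outer half.\<close>

lemma wheel_crossing_number:
  assumes "e \<in> wheel_E" shows "crossing_number wheel_edge 2 spoke_axis e \<le> 1"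
proof -
  obtain j where j: "\<And>i t. i < 2 \<Longrightarrow> 0 < t \<Longrightarrow> t < 1 \<Longrightarrow> wheel_edge e t \<in> range (spoke_axis i) \<Longrightarrow> i = j"
    using assms
  proof (cases rule: wheel_E_cases)
    case (inner q)
    then have "i = q mod 2" if "i < 2" "0 < t" "t < 1" "wheel_edge e t \<in> range (spoke_axis i)" for i t
      using that arm_on_axis_iff[of "-1 + 3 / 2 * t" i q] by (auto simp: inner_edge split: if_splits)
    then show ?thesis using that by blast
  next
    case (outer q)
    then have "i = 1 - q mod 2" if "i < 2" "0 < t" "t < 1" "wheel_edge e t \<in> range (spoke_axis i)" for i t
      using that arm_on_axis_iff[of "2 - 3 / 2 * t" i q] by (auto simp: outer_edge split: if_splits)
    then show ?thesis using that by blast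
  qed
  then have "{i. i < 2 \<and> range (spoke_axis i) \<inter> wheel_edge e ` {0<..<1} \<noteq> {}} \<subseteq> {j}" by force
  then have "card {i. i < 2 \<and> range (spoke_axis i) \<inter> wheel_edge e ` {0<..<1} \<noteq> {}} \<le> card {j}"
    by (intro card_mono) auto
  then show ?thesis by (simp add: crossing_number_def)
qed

lemma wheel_alignment_complexity:
  "alignment_complexity wheel_E wheel_pos wheel_edge 2 spoke_axis None (Some 1) None"
  unfolding alignment_complexity_def Let_def
proof (intro ballI conjI impI allI)
  fix i :: nat assume "i \<in> {0, 1, 2}" "[None, Some 1, None] ! i = None"
  then have "i \<noteq> 1" by auto
  then show "{e \<in> wheel_E. anchoring wheel_pos 2 spoke_axis e = i} = {}"
    using wheel_anchored_once(3) by auto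
next
  fix i m :: nat and e assume "i \<in> {0, 1, 2}" "[None, Some 1, None] ! i = Some m" "e \<in> wheel_E"
  then show "crossing_number wheel_edge 2 spoke_axis e \<le> m" using wheel_crossing_number[of e] by auto
qed

section \<open>The cells of the axis arrangement\<close>

text \<open>The open quadrant between rays \<open>k\<close> and \<open>k + 1\<close>. Indices are
  not reduced modulo 4, so arm \<open>q\<close> visits \<open>cell (q + 3)\<close>,
  \<open>cell q\<close> and \<open>cell (q + 1)\<close> in turn; \<open>cell_add_4\<close>
  reconciles the names.\<close>

definition cell :: "nat \<Rightarrow> pt set" where
  "cell k = {p. 0 < proj (real k) p \<and> 0 < proj (real k + 1) p}"

lemma proj_numeral:
  "proj 2 p = - proj 0 p" "proj 3 p = - proj 1 p" "proj 4 p = proj 0 p" "proj 5 p = proj 1 p"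
  using proj_add_2[of 0 p] proj_add_2[of 1 p] proj_add_2[of 2 p] proj_add_2[of 3 p] by simp_all

lemma axes_Un: "(\<Union>i<2. range (spoke_axis i)) = {p. proj 0 p = 0 \<or> proj 1 p = 0}"
proof -
  have "(\<Union>i<2. range (spoke_axis i)) = range (spoke_axis 0) \<union> range (spoke_axis 1)"
    by (auto simp: lessThan_nat_numeral lessThan_Suc numeral_2_eq_2)
  then show ?thesis by (auto simp: range_spoke_axis proj_numeral)
qed

lemma proj_not_0_off_axes:
  assumes "p \<notin> (\<Union>i<2. range (spoke_axis i))" shows "proj (real k) p \<noteq> 0"
proof (induction k rule: nat_induct2)
  case (step k)
  then show ?case using proj_add_2[of "real k" p] by (simp add: add.commute)
qed (use assms axes_Un in auto)

lemma proj_eq_inner: "proj \<theta> p = inner (dir \<theta>) p"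
  by (simp add: proj_def inner_vec_def sum_2 mult.commute)

lemma connected_cell: "connected (cell k)"
proof -
  have "cell k = {p. inner (dir (real k)) p > 0} \<inter> {p. inner (dir (real k + 1)) p > 0}"
    by (auto simp: cell_def proj_eq_inner)
  then show ?thesis by (simp add: convex_Int convex_connected convex_halfspace_gt)
qed

lemma cell_off_axes: "cell k \<subseteq> - (\<Union>i<2. range (spoke_axis i))"
proof -
  have "proj (real k) p = 0 \<or> proj (real k + 1) p = 0"
    if "i < 2" "p \<in> range (spoke_axis i)" for i p
    using that range_spoke_axis_mod_2[of k] range_spoke_axis_other[of i k] by (cases "i = k mod 2") auto
  then show ?thesis by (fastforce simp: cell_def)
qed

lemma arm_in_cell:
  "0 < \<sigma> \<Longrightarrow> \<sigma> < 1 \<Longrightarrow> arm (real q) \<sigma> \<in> cell q"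
  "1 < \<sigma> \<Longrightarrow> \<sigma> < 2 \<Longrightarrow> arm (real q) \<sigma> \<in> cell (q + 1)"
  "-1 < \<sigma> \<Longrightarrow> \<sigma> < 0 \<Longrightarrow> arm (real q) \<sigma> \<in> cell (q + 3)"
proof -
  have p: "proj (real (q + 1) + 1) x = - proj (real q) x" "proj (real (q + 3)) x = - proj (real q + 1) x"
    "proj (real (q + 3) + 1) x = proj (real q) x" for x
    using proj_add_2[of "real q" x] proj_add_2[of "real q + 1" x] proj_add_2[of "real q + 2" x]
    by (simp_all add: add_ac)
  show "0 < \<sigma> \<Longrightarrow> \<sigma> < 1 \<Longrightarrow> arm (real q) \<sigma> \<in> cell q"
    using cos_half_pi_pos[of \<sigma>] sin_half_pi_pos[of \<sigma>] by (simp add: cell_def proj_arm proj_arm_Suc)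
  show "1 < \<sigma> \<Longrightarrow> \<sigma> < 2 \<Longrightarrow> arm (real q) \<sigma> \<in> cell (q + 1)"
    unfolding cell_def p using cos_half_pi_neg[of \<sigma>] sin_half_pi_pos[of \<sigma>]
    by (simp add: proj_arm proj_arm_Suc add.commute[of 1] mult_less_0_iff)
  show "-1 < \<sigma> \<Longrightarrow> \<sigma> < 0 \<Longrightarrow> arm (real q) \<sigma> \<in> cell (q + 3)"
    unfolding cell_def p using cos_half_pi_pos[of \<sigma>] sin_half_pi_neg[of \<sigma>]
    by (simp add: proj_arm proj_arm_Suc mult_less_0_iff)
qed

text \<open>A connected set off the axes keeps the sign of every \<open>proj (real m)\<close>. If it
  contains the cell, it contains the test point \<open>arm (real k) (1/2)\<close>, whose signs are
  the ones that define the cell.\<close>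

lemma cell_in_components: "cell k \<in> components (- (\<Union>i<2. range (spoke_axis i)))"
  unfolding in_components_maximal
proof (intro conjI allI impI)
  have ne: "arm (real k) (1/2) \<in> cell k" by (simp add: arm_in_cell)
  then show "cell k \<noteq> {}" by blast
  show "cell k \<subseteq> - (\<Union>i<2. range (spoke_axis i))" by (rule cell_off_axes)
  show "connected (cell k)" by (rule connected_cell)
  fix D assume D: "D \<noteq> {} \<and> cell k \<subseteq> D \<and> D \<subseteq> - (\<Union>i<2. range (spoke_axis i)) \<and> connected D"
  have "0 < proj (real m) x" if x: "x \<in> D" and m: "0 < proj (real m) (arm (real k) (1/2))" for x m
  proof -
    have "proj (real m) (arm (real k) (1/2)) * proj (real m) x > 0"
    proof (rule connected_nonzero_same_sign[of D])
      show "connected D" "arm (real k) (1/2) \<in> D" "x \<in> D" using D ne x by auto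
      show "proj (real m) y \<noteq> 0" if "y \<in> D" for y using D that by (intro proj_not_0_off_axes) blast
    qed (rule continuous_on_proj)
    then show ?thesis using m by (simp add: zero_less_mult_iff)
  qed
  from this[of _ k] this[of _ "Suc k"] show "D = cell k"
    using D ne by (fastforce simp: cell_def add.commute[of 1])
qed

lemma cell_Int: "j < 4 \<Longrightarrow> k < 4 \<Longrightarrow> j \<noteq> k \<Longrightarrow> cell j \<inter> cell k = {}"
proof -
  assume jk: "j < 4" "k < 4" "j \<noteq> k"
  have "j = 0 \<or> j = 1 \<or> j = 2 \<or> j = 3" "k = 0 \<or> k = 1 \<or> k = 2 \<or> k = 3" using jk by linarith+
  then show ?thesis using jk by (elim disjE) (auto simp: cell_def proj_numeral)
qed

section \<open>Cells visited by the edges, and objects met by the axes\<close>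

lemma inner_meets_cells:
  assumes "q < 4" shows "path_meets_before (wheel_edge (q, 8 + q)) (cell (q + 3)) (cell q)"
  unfolding path_meets_before_def
  \<comment> \<open>These parameters correspond to \<open>\<sigma> = -1/2\<close> and
    \<open>\<sigma> = 1/4\<close>.\<close>
  by (rule exI[of _ "1/3"], rule exI[of _ "5/6"]) (use assms arm_in_cell in \<open>auto simp: inner_edge\<close>)

lemma outer_meets_cells:
  assumes "q < 4" shows "path_meets_before (wheel_edge (4 + q, 8 + q)) (cell (q + 1)) (cell q)"
  unfolding path_meets_before_def
  by (rule exI[of _ "1/3"], rule exI[of _ "5/6"]) (use assms arm_in_cell in \<open>auto simp: outer_edge\<close>)

lemma cell_add_4: "cell (k + 4) = cell k"
proof -
  have "proj (\<theta> + 4) p = proj \<theta> p" for \<theta> p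
    using proj_add_2[of \<theta> p] proj_add_2[of "\<theta> + 2" p] by (simp add: add_ac)
  from this[of "real k"] this[of "real k + 1"] show ?thesis by (simp add: cell_def add_ac)
qed

lemma dir_add_2: "dir (\<theta> + 2) = - dir \<theta>"
  by (simp add: pt_eq_iff distrib_right add_divide_distrib cos_add sin_add)

text \<open>At the distances 1 to 4 ray \<open>q\<close> meets the inner end of arm
  \<open>q + 1\<close>, the inner half of arm \<open>q\<close>, the outer half of arm
  \<open>q - 1\<close> and the outer end of arm \<open>q - 2\<close>, with indices modulo 4.
  Negative parameters belong to rays 2 and 3.\<close>

lemma wheel_on_spoke_axis:
  "spoke_axis 0 1 \<in> obj wheel_pos wheel_edge (Inl 1)" "spoke_axis 0 (-1) \<in> obj wheel_pos wheel_edge (Inl 3)"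
  "spoke_axis 1 1 \<in> obj wheel_pos wheel_edge (Inl 2)" "spoke_axis 1 (-1) \<in> obj wheel_pos wheel_edge (Inl 0)"
  "spoke_axis 0 2 \<in> obj wheel_pos wheel_edge (Inr (0, 8))" "spoke_axis 0 (-2) \<in> obj wheel_pos wheel_edge (Inr (2, 10))"
  "spoke_axis 1 2 \<in> obj wheel_pos wheel_edge (Inr (1, 9))" "spoke_axis 1 (-2) \<in> obj wheel_pos wheel_edge (Inr (3, 11))"
  "spoke_axis 0 3 \<in> obj wheel_pos wheel_edge (Inr (7, 11))" "spoke_axis 0 (-3) \<in> obj wheel_pos wheel_edge (Inr (5, 9))"
  "spoke_axis 1 3 \<in> obj wheel_pos wheel_edge (Inr (4, 8))" "spoke_axis 1 (-3) \<in> obj wheel_pos wheel_edge (Inr (6, 10))"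
  "spoke_axis 0 4 \<in> obj wheel_pos wheel_edge (Inl 6)" "spoke_axis 0 (-4) \<in> obj wheel_pos wheel_edge (Inl 4)"
  "spoke_axis 1 4 \<in> obj wheel_pos wheel_edge (Inl 7)" "spoke_axis 1 (-4) \<in> obj wheel_pos wheel_edge (Inl 5)"
proof -
  have d: "dir 2 = - dir 0" "dir 3 = - dir 1" "dir 4 = dir 0" "dir 5 = dir 1" "dir (-1) = - dir 1"
    using dir_add_2[of 0] dir_add_2[of 1] dir_add_2[of 2] dir_add_2[of 3] dir_add_2[of "-1"] by simp_all
  have v: "arm (real q) (-1) \<in> obj wheel_pos wheel_edge (Inl q)"
    "arm (real q) 2 \<in> obj wheel_pos wheel_edge (Inl (4 + q))"
    "arm (real q) 0 \<in> obj wheel_pos wheel_edge (Inr (q, 8 + q))"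
    "arm (real q) 1 \<in> obj wheel_pos wheel_edge (Inr (4 + q, 8 + q))" if "q < 4" for q
    using that by (auto simp: obj_def wheel_pos_simps image_inner image_outer)
  show "spoke_axis 0 1 \<in> obj wheel_pos wheel_edge (Inl 1)" using v(1)[of 1] by (simp add: arm_def spoke_axis_def)
  show "spoke_axis 0 (-1) \<in> obj wheel_pos wheel_edge (Inl 3)" using v(1)[of 3] d by (simp add: arm_def spoke_axis_def)
  show "spoke_axis 1 1 \<in> obj wheel_pos wheel_edge (Inl 2)" using v(1)[of 2] d by (simp add: arm_def spoke_axis_def)
  show "spoke_axis 1 (-1) \<in> obj wheel_pos wheel_edge (Inl 0)" using v(1)[of 0] d by (simp add: arm_def spoke_axis_def)
  show "spoke_axis 0 2 \<in> obj wheel_pos wheel_edge (Inr (0, 8))" using v(3)[of 0] d by (simp add: arm_def spoke_axis_def)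
  show "spoke_axis 0 (-2) \<in> obj wheel_pos wheel_edge (Inr (2, 10))" using v(3)[of 2] d by (simp add: arm_def spoke_axis_def)
  show "spoke_axis 1 2 \<in> obj wheel_pos wheel_edge (Inr (1, 9))" using v(3)[of 1] d by (simp add: arm_def spoke_axis_def)
  show "spoke_axis 1 (-2) \<in> obj wheel_pos wheel_edge (Inr (3, 11))" using v(3)[of 3] d by (simp add: arm_def spoke_axis_def)
  show "spoke_axis 0 3 \<in> obj wheel_pos wheel_edge (Inr (7, 11))" using v(4)[of 3] d by (simp add: arm_def spoke_axis_def)
  show "spoke_axis 0 (-3) \<in> obj wheel_pos wheel_edge (Inr (5, 9))" using v(4)[of 1] d by (simp add: arm_def spoke_axis_def)
  show "spoke_axis 1 3 \<in> obj wheel_pos wheel_edge (Inr (4, 8))" using v(4)[of 0] d by (simp add: arm_def spoke_axis_def)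
  show "spoke_axis 1 (-3) \<in> obj wheel_pos wheel_edge (Inr (6, 10))" using v(4)[of 2] d by (simp add: arm_def spoke_axis_def)
  show "spoke_axis 0 4 \<in> obj wheel_pos wheel_edge (Inl 6)" using v(2)[of 2] d by (simp add: arm_def spoke_axis_def)
  show "spoke_axis 0 (-4) \<in> obj wheel_pos wheel_edge (Inl 4)" using v(2)[of 0] d by (simp add: arm_def spoke_axis_def)
  show "spoke_axis 1 4 \<in> obj wheel_pos wheel_edge (Inl 7)" using v(2)[of 3] d by (simp add: arm_def spoke_axis_def)
  show "spoke_axis 1 (-4) \<in> obj wheel_pos wheel_edge (Inl 5)" using v(2)[of 1] d by (simp add: arm_def spoke_axis_def)
qed

section \<open>Straight-line drawings\<close>

text \<open>The two lines supply affine coordinates \<open>A\<close> and \<open>B\<close>. The cell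
  conditions fix their signs at the vertices off the respective line, condition (v) compares
  crossings along the rays, and \<open>quarter_turn\<close> is applied once per ray.\<close>

lemma no_aligned_drawing_wheel:
  "\<not> aligned_drawing wheel_V wheel_E wheel_pos wheel_edge 2 spoke_axis p L"
proof
  assume ad: "aligned_drawing wheel_V wheel_E wheel_pos wheel_edge 2 spoke_axis p L"
  define Ob where "Ob = obj p (seg p)"
  have E: "(z, 8 + z mod 4) \<in> wheel_E" if "z < 8" for z using that by (auto simp: wheel_E_def)
  have plane: "plane_drawing wheel_V wheel_E p (seg p)" and dL: "\<And>i. i < 2 \<Longrightarrow> snd (L i) \<noteq> 0"
    using ad by (auto simp: aligned_drawing_def)
  have pl: "path_image (seg p e) \<inter> path_image (seg p e') \<subseteq> p ` ({fst e, snd e} \<inter> {fst e', snd e'})"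
    if "e \<in> wheel_E" "e' \<in> wheel_E" "e \<noteq> e'" for e e'
    using plane that unfolding plane_drawing_def by blast
  \<comment> \<open>Halves of different arms share no endpoint, so planarity of the straight-line
    drawing makes them disjoint.\<close>
  have disj: "closed_segment (p q) (p (8 + q)) \<inter> closed_segment (p (4 + r)) (p (8 + r)) = {}"
    if "q < 4" "r < 4" "q \<noteq> r" for q r
  proof -
    have "(q, 8 + q) \<in> wheel_E" "(4 + r, 8 + r) \<in> wheel_E" using E[of q] E[of "4 + r"] that by simp_all
    then have "path_image (seg p (q, 8 + q)) \<inter> path_image (seg p (4 + r, 8 + r)) \<subseteq> {}"
      using pl[of "(q, 8 + q)" "(4 + r, 8 + r)"] that by auto
    then show ?thesis by (simp add: seg_def)
  qed
  define cells where "cells = components (- (\<Union>i<2. range (spoke_axis i)))"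
  note conds = ad[unfolded aligned_drawing_def Let_def, folded cells_def, THEN conjunct2, THEN conjunct2, THEN conjunct2]
  obtain g g' where gg': "homeomorphism UNIV UNIV g g' \<and>
      (\<forall>i<2. g ` range (spoke_axis i) = range (line_curve (L i))) \<and>
      (\<forall>C\<in>cells. \<forall>v\<in>wheel_V. wheel_pos v \<in> C \<longleftrightarrow> p v \<in> g ` C) \<and>
      (\<forall>C\<in>cells. \<forall>e\<in>wheel_E. path_image (wheel_edge e) \<inter> C \<noteq> {} \<longleftrightarrow> path_image (seg p e) \<inter> g ` C \<noteq> {}) \<and>
      (\<forall>e\<in>wheel_E. \<forall>C\<in>cells. \<forall>C'\<in>cells.
        path_meets_before (wheel_edge e) C C' \<longleftrightarrow> path_meets_before (seg p e) (g ` C) (g ` C'))"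
    using conds[THEN conjunct1] by (elim exE)
  note g = gg'[THEN conjunct1]
    and gX = gg'[THEN conjunct2, THEN conjunct1, rule_format]
    and gV = gg'[THEN conjunct2, THEN conjunct2, THEN conjunct1, rule_format]
    and gE = gg'[THEN conjunct2, THEN conjunct2, THEN conjunct2, THEN conjunct2, rule_format]
  have cells: "cell k \<in> cells" for k unfolding cells_def by (rule cell_in_components)
  have g'g: "g' (g x) = x" and g_g': "g (g' x) = x" for x using g by (auto simp: homeomorphism_def)
  have contg: "continuous_on S g" "continuous_on S g'" for S
    using continuous_on_subset[OF homeomorphism_cont1[OF g] subset_UNIV]
      continuous_on_subset[OF homeomorphism_cont2[OF g] subset_UNIV] .
  note lines = conds[THEN conjunct2, rule_format, folded Ob_def]
  have meets: "range (line_curve (L i)) \<inter> Ob x \<noteq> {}" 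
    if "i < 2" "x \<in> graph_objects wheel_V wheel_E" "range (spoke_axis i) \<inter> obj wheel_pos wheel_edge x \<noteq> {}" for i x
    using lines[OF that(1,2,2)] that(3) by simp
  have order: "curve_meets_before (line_curve (L i)) (Ob x) (Ob y)"
    if "i < 2" "x \<in> graph_objects wheel_V wheel_E" "y \<in> graph_objects wheel_V wheel_E"
      "spoke_axis i s \<in> obj wheel_pos wheel_edge x" "spoke_axis i t \<in> obj wheel_pos wheel_edge y" "s < t" for i x y s t
  proof -
    have "curve_meets_before (spoke_axis i) (obj wheel_pos wheel_edge x) (obj wheel_pos wheel_edge y)"
      using that by (auto simp: curve_meets_before_def)
    then show ?thesis using lines[OF that(1-3)] by simp
  qed
  have go: "Inl v \<in> graph_objects wheel_V wheel_E" if "v < 12" for v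
    using that by (simp add: graph_objects_def wheel_V_def)
  have goE: "Inr (z, 8 + z mod 4) \<in> graph_objects wheel_V wheel_E" if "z < 8" for z
    using E[OF that] by (simp add: graph_objects_def)
  have Ob_simps: "Ob (Inl v) = {p v}" "Ob (Inr (z, u)) = closed_segment (p z) (p u)" for v z u
    by (auto simp: Ob_def obj_def seg_def)

  define Q where "Q k = g ` cell k" for k
  define A0 where "A0 = line_fun (L 1)"
  define B0 where "B0 = line_fun (L 0)"
  have A0_iff: "A0 x = 0 \<longleftrightarrow> x \<in> range (line_curve (L 1))" and B0_iff: "B0 x = 0 \<longleftrightarrow> x \<in> range (line_curve (L 0))" for x
    using dL by (auto simp: A0_def B0_def line_fun_eq_0_iff)
  have aff0: "affine_fun A0" "affine_fun B0" by (auto simp: A0_def B0_def affine_line_fun)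
  have off: "A0 x \<noteq> 0 \<and> B0 x \<noteq> 0 \<longleftrightarrow> g' x \<in> - (\<Union>i<2. range (spoke_axis i))" for x
  proof -
    have "x \<in> range (line_curve (L i)) \<longleftrightarrow> g' x \<in> range (spoke_axis i)" if "i < 2" for i
    proof -
      have "x \<in> g ` range (spoke_axis i) \<longleftrightarrow> g' x \<in> range (spoke_axis i)"
      proof
        assume "g' x \<in> range (spoke_axis i)"
        then have "g (g' x) \<in> g ` range (spoke_axis i)" by (rule imageI)
        then show "x \<in> g ` range (spoke_axis i)" by (simp only: g_g')
      qed (auto simp only: image_iff g'g)
      then show ?thesis by (simp only: gX[OF that])
    qed
    moreover have "(\<Union>i<2. range (spoke_axis i)) = range (spoke_axis 0) \<union> range (spoke_axis 1)"
      by (auto simp: less_2_cases_iff)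
    ultimately show ?thesis by (simp only: A0_iff B0_iff) (simp add: conj_commute)
  qed
  have Q_off: "A0 x \<noteq> 0 \<and> B0 x \<noteq> 0" if "x \<in> Q k" for x k
  proof -
    have "g' x \<in> cell k" using that by (auto simp only: Q_def g'g)
    then show ?thesis using cell_off_axes[of k] off[of x] by blast
  qed
  have same: "A0 x * A0 y > 0" "B0 x * B0 y > 0" if "x \<in> Q k" "y \<in> Q k" for x y k
  proof -
    have "connected (Q k)" unfolding Q_def using connected_cell contg connected_continuous_image by blast
    then show "A0 x * A0 y > 0" "B0 x * B0 y > 0"
      using that Q_off unfolding A0_def B0_def
      by (auto intro!: connected_nonzero_same_sign[of "Q k"] continuous_on_line_fun)
  qed
  \<comment> \<open>Equal signs at \<open>x\<close> and \<open>y\<close> would keep the segment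
    between them off both lines. Its image under \<open>g'\<close> would then be a connected set off
    the axes that meets two different cells.\<close>
  have separated: "\<not> (A0 x * A0 y > 0 \<and> B0 x * B0 y > 0)" if "x \<in> Q j" "y \<in> Q k" "j < 4" "k < 4" "j \<noteq> k" for x y j k
  proof
    assume pos: "A0 x * A0 y > 0 \<and> B0 x * B0 y > 0"
    define S where "S = g' ` closed_segment x y"
    have "g' z \<in> - (\<Union>i<2. range (spoke_axis i))" if z: "z \<in> closed_segment x y" for z
      unfolding off[symmetric]
      using affine_nonzero_on_segment[OF aff0(1) _ z] affine_nonzero_on_segment[OF aff0(2) _ z] pos by simp
    then have S: "S \<subseteq> - (\<Union>i<2. range (spoke_axis i))" unfolding S_def by (rule image_subsetI)
    have conn: "connected S" unfolding S_def by (intro connected_continuous_image contg connected_segment)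
    have x: "g' x \<in> cell j" and y: "g' y \<in> cell k" using that(1,2) by (auto simp only: Q_def g'g)
    have xS: "g' x \<in> S" and yS: "g' y \<in> S" unfolding S_def by (auto intro!: imageI)
    have "cell j \<inter> S \<noteq> {}" using x xS by blast
    then have "S \<subseteq> cell j" by (rule components_maximal[OF cell_in_components conn S])
    then have "g' y \<in> cell j \<inter> cell k" using y yS by blast
    then show False using cell_Int[OF that(3-5)] by simp
  qed
  have tip: "p (8 + k) \<in> Q k" if "k < 4" for k
    using that gV[OF cells[of k], of "8 + k"] arm_in_cell(1)[of "1/2" k]
    by (simp add: Q_def wheel_pos_simps wheel_V_def)
  have inner: "\<exists>s t. 0 \<le> s \<and> s < t \<and> linepath (p q) (p (8 + q)) s \<in> g ` cell (q + 3) \<and> linepath (p q) (p (8 + q)) t \<in> Q q"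
    if "q < 4" for q
  proof -
    have "(q, 8 + q) \<in> wheel_E" using E[of q] that by simp
    from gE[OF this cells cells] have "path_meets_before (seg p (q, 8 + q)) (g ` cell (q + 3)) (Q q)"
      using inner_meets_cells[OF that] by (simp add: Q_def)
    then show ?thesis unfolding path_meets_before_def seg_def fst_conv snd_conv by blast
  qed
  have outer: "\<exists>s t. 0 \<le> s \<and> s < t \<and> linepath (p (4 + q)) (p (8 + q)) s \<in> g ` cell (q + 1) \<and> linepath (p (4 + q)) (p (8 + q)) t \<in> Q q"
    if "q < 4" for q
  proof -
    have "(4 + q, 8 + q) \<in> wheel_E" using E[of "4 + q"] that by simp
    from gE[OF this cells cells] have "path_meets_before (seg p (4 + q, 8 + q)) (g ` cell (q + 1)) (Q q)"
      using outer_meets_cells[OF that] by (simp add: Q_def)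
    then show ?thesis unfolding path_meets_before_def seg_def fst_conv snd_conv by blast
  qed
  have onL: "p v \<in> range (line_curve (L i))"
    if "spoke_axis i t \<in> obj wheel_pos wheel_edge (Inl v)" "i < 2" "v < 12" for i t v
  proof -
    have "range (spoke_axis i) \<inter> obj wheel_pos wheel_edge (Inl v) \<noteq> {}" using that(1) by blast
    from meets[OF that(2) go[OF that(3)] this] show ?thesis by (simp add: Ob_simps)
  qed
  have on: "A0 (p 0) = 0" "A0 (p 2) = 0" "A0 (p 5) = 0" "A0 (p 7) = 0"
    "B0 (p 1) = 0" "B0 (p 3) = 0" "B0 (p 4) = 0" "B0 (p 6) = 0"
    unfolding A0_iff B0_iff by (rule onL, rule wheel_on_spoke_axis, simp, simp)+
  \<comment> \<open>Scaling by the value at \<open>p 8\<close> makes both coordinates positive there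
    and hence on all of \<open>Q 0\<close>, whatever the directions of the lines.\<close>
  define A where "A x = A0 (p 8) * A0 x" for x
  define B where "B x = B0 (p 8) * B0 x" for x
  have aff: "affine_fun A" "affine_fun B"
    unfolding A_def B_def using aff0 by (auto intro: affine_fun_cmult)
  have aff': "affine_fun (\<lambda>x. - A x)" "affine_fun (\<lambda>x. - B x)" using aff affine_fun_uminus by auto
  have tip_off: "A0 (p 8) \<noteq> 0" "B0 (p 8) \<noteq> 0" using Q_off tip[of 0] by auto
  have zero_iff: "A x = 0 \<longleftrightarrow> x \<in> range (line_curve (L 1))" "B x = 0 \<longleftrightarrow> x \<in> range (line_curve (L 0))" for x
    using tip_off by (simp_all add: A_def B_def A0_iff B0_iff)
  have AB_mult: "A x * A y > 0 \<longleftrightarrow> A0 x * A0 y > 0" "B x * B y > 0 \<longleftrightarrow> B0 x * B0 y > 0" for x y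
    using tip_off by (auto simp: A_def B_def zero_less_mult_iff mult_less_0_iff linorder_neq_iff)
  have inj: "x = y" if "A x = A y" "B x = B y" for x y
  proof (rule line_funs_inj)
    have "g ` (range (spoke_axis 0) \<inter> range (spoke_axis 1)) = g ` range (spoke_axis 0) \<inter> g ` range (spoke_axis 1)"
      using g'g by (intro image_Int) (metis injI)
    then show "range (line_curve (L 0)) \<inter> range (line_curve (L 1)) = {g 0}"
      using gX[of 0] gX[of 1] spoke_axes_Int by simp
    show "snd (L 0) \<noteq> 0" "snd (L 1) \<noteq> 0" using dL by auto
    show "line_fun (L 0) x = line_fun (L 0) y" "line_fun (L 1) x = line_fun (L 1) y"
      using that tip_off by (auto simp: A_def B_def A0_def B0_def)
  qed
  \<comment> \<open>An affine function that vanishes at the start of an edge is a multiple of the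
    parameter, so it keeps its sign from then on.\<close>
  have start: "F P * F P' > 0" if "affine_fun F" "F a = 0" "0 \<le> s" "s < t" "F P \<noteq> 0"
    "P = linepath a u s" "P' = linepath a u t" for F a s t u P P'
  proof -
    have "F P = s * F u" "F P' = t * F u" using that by (simp_all add: affine_fun_linepath)
    moreover from this have "s > 0" "F u \<noteq> 0" using that by auto
    ultimately have "F P * F P' = (s * t) * (F u * F u)" and "(s * t) * (F u * F u) > 0"
      using \<open>s < t\<close> by (auto simp: zero_less_mult_iff linorder_neq_iff)
    then show ?thesis by (simp only:)
  qed

  have S0: "A x > 0 \<and> B x > 0" if "x \<in> Q 0" for x
    using same[OF that tip[of 0, simplified]] by (simp add: A_def B_def mult.commute)
  have Q_nz: "A x \<noteq> 0" "B x \<noteq> 0" if "x \<in> Q k" for x k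
    using Q_off[OF that] tip_off by (auto simp: A_def B_def)
  \<comment> \<open>The inner edge of arm \<open>k + 1\<close> leads from \<open>Q k\<close> to
    \<open>Q (k + 1)\<close>. It starts on one of the lines, so the function of that line keeps its
    sign by \<open>start\<close>, and \<open>separated\<close> forces the other one to
    change.\<close>
  have next_quadrant: "\<exists>P P'. P \<in> Q k \<and> P' \<in> Q (k + 1) \<and>
      (if even k then B P * B P' > 0 \<and> A P * A P' < 0 else A P * A P' > 0 \<and> B P * B P' < 0)" if k: "k < 3" for k
  proof -
    have "k + 1 < 4" using k by simp
    from inner[OF this] obtain s t where st: "0 \<le> s" "s < t" "linepath (p (k + 1)) (p (8 + (k + 1))) s \<in> g ` cell (k + 1 + 3)"
      "linepath (p (k + 1)) (p (8 + (k + 1))) t \<in> Q (k + 1)"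
      by blast
    define P P' where "P = linepath (p (k + 1)) (p (8 + (k + 1))) s" and "P' = linepath (p (k + 1)) (p (8 + (k + 1))) t"
    have "cell (k + 1 + 3) = cell k" using cell_add_4[of k] by (simp add: add.commute)
    then have PP': "P \<in> Q k" "P' \<in> Q (k + 1)" using st by (simp_all add: P_def P'_def Q_def)
    have nz: "A P * A P' \<noteq> 0" "B P * B P' \<noteq> 0" using PP' Q_nz by auto
    have sep: "\<not> (A P * A P' > 0 \<and> B P * B P' > 0)"
      using separated[OF PP'] k by (simp add: AB_mult)
    have "if even k then B (p (k + 1)) = 0 else A (p (k + 1)) = 0"
      using on k by (auto simp: A_def B_def less_Suc_eq numeral_3_eq_3 numeral_2_eq_2)
    then have near: "if even k then B P * B P' > 0 else A P * A P' > 0"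
      using start[OF aff(1) _ st(1,2) _ P_def P'_def] start[OF aff(2) _ st(1,2) _ P_def P'_def] Q_nz[OF PP'(1)]
      by (auto split: if_splits)
    have "if e then y > 0 \<and> x < 0 else x > 0 \<and> y < 0"
      if "if e then y > 0 else x > 0" "\<not> (x > 0 \<and> y > 0)" "x \<noteq> 0" "y \<noteq> 0" for x y :: real and e
      using that by (cases e) auto
    from this[OF near sep nz] PP' show ?thesis by blast
  qed
  have same': "A x * A y > 0" "B x * B y > 0" if "x \<in> Q k" "y \<in> Q k" for x y k
    using same[OF that] by (simp_all add: AB_mult)
  have S1: "A x < 0 \<and> B x > 0" if "x \<in> Q 1" for x
  proof -
    obtain P P' where P: "P \<in> Q 0" "P' \<in> Q 1" "B P * B P' > 0" "A P * A P' < 0"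
      using next_quadrant[of 0] by auto
    then show ?thesis using S0[OF P(1)] same'[OF that P(2)] by (auto simp: zero_less_mult_iff mult_less_0_iff)
  qed
  have S2: "A x < 0 \<and> B x < 0" if "x \<in> Q 2" for x
  proof -
    obtain P P' where P: "P \<in> Q 1" "P' \<in> Q 2" "A P * A P' > 0" "B P * B P' < 0"
      using next_quadrant[of 1] by (auto simp: numeral_2_eq_2)
    then show ?thesis using S1[OF P(1)] same'[OF that P(2)] by (auto simp: zero_less_mult_iff mult_less_0_iff)
  qed
  have S3: "A x > 0 \<and> B x < 0" if "x \<in> Q 3" for x
  proof -
    obtain P P' where P: "P \<in> Q 2" "P' \<in> Q 3" "B P * B P' > 0" "A P * A P' < 0"
      using next_quadrant[of 2] by auto
    then show ?thesis using S2[OF P(1)] same'[OF that P(2)] by (auto simp: zero_less_mult_iff mult_less_0_iff)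
  qed
  have cell_mod: "cell 4 = cell 0" "cell 5 = cell 1" "cell 6 = cell 2"
    using cell_add_4[of 0] cell_add_4[of 1] cell_add_4[of 2] by simp_all
  have u: "A (p 8) > 0" "B (p 8) > 0" "A (p 9) < 0" "B (p 9) > 0" "A (p 10) < 0" "B (p 10) < 0"
    "A (p 11) > 0" "B (p 11) < 0"
    using S0 tip[of 0] S1 tip[of 1] S2 tip[of 2] S3 tip[of 3] by auto
  \<comment> \<open>The inner edge of arm \<open>q\<close> passes from \<open>Q (q - 1)\<close> to
    \<open>Q q\<close>, indices modulo 4. The coordinate that changes sign on the way reveals the
    side of its start.\<close>
  have a: "B (p 0) < 0" "A (p 1) > 0" "B (p 2) > 0" "A (p 3) < 0"
  proof -
    obtain s t where "0 \<le> s" "s < t" "linepath (p 0) (p 8) s \<in> Q 3" "linepath (p 0) (p 8) t \<in> Q 0"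
      using inner[of 0] by (auto simp: Q_def)
    then show "B (p 0) < 0" using affine_start_neg[OF aff(2), of s t] S3 S0 by blast
    obtain s t where "0 \<le> s" "s < t" "linepath (p 1) (p 9) s \<in> Q 0" "linepath (p 1) (p 9) t \<in> Q 1"
      using inner[of 1] by (auto simp: Q_def cell_mod)
    then show "A (p 1) > 0" using affine_start_neg[OF aff'(1), of s t "p 1" "p 9"] S0 S1 by simp
    obtain s t where "0 \<le> s" "s < t" "linepath (p 2) (p 10) s \<in> Q 1" "linepath (p 2) (p 10) t \<in> Q 2"
      using inner[of 2] by (auto simp: Q_def cell_mod)
    then show "B (p 2) > 0" using affine_start_neg[OF aff'(2), of s t "p 2" "p 10"] S1 S2 by simp
    obtain s t where "0 \<le> s" "s < t" "linepath (p 3) (p 11) s \<in> Q 2" "linepath (p 3) (p 11) t \<in> Q 3"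
      using inner[of 3] by (auto simp: Q_def cell_mod)
    then show "A (p 3) < 0" using affine_start_neg[OF aff(1), of s t] S2 S3 by blast
  qed
  \<comment> \<open>The same argument for the outer edges, which pass from \<open>Q (q + 1)\<close>
    to \<open>Q q\<close>.\<close>
  have b: "A (p 4) < 0" "B (p 5) < 0" "A (p 6) > 0" "B (p 7) > 0"
  proof -
    obtain s t where "0 \<le> s" "s < t" "linepath (p 4) (p 8) s \<in> Q 1" "linepath (p 4) (p 8) t \<in> Q 0"
      using outer[of 0] by (auto simp: Q_def)
    then show "A (p 4) < 0" using affine_start_neg[OF aff(1), of s t] S1 S0 by blast
    obtain s t where "0 \<le> s" "s < t" "linepath (p 5) (p 9) s \<in> Q 2" "linepath (p 5) (p 9) t \<in> Q 1"
      using outer[of 1] by (auto simp: Q_def numeral_2_eq_2)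
    then show "B (p 5) < 0" using affine_start_neg[OF aff(2), of s t] S2 S1 by blast
    obtain s t where "0 \<le> s" "s < t" "linepath (p 6) (p 10) s \<in> Q 3" "linepath (p 6) (p 10) t \<in> Q 2"
      using outer[of 2] by (auto simp: Q_def)
    then show "A (p 6) > 0" using affine_start_neg[OF aff'(1), of s t "p 6" "p 10"] S3 S2 by simp
    obtain s t where "0 \<le> s" "s < t" "linepath (p 7) (p 11) s \<in> Q 0" "linepath (p 7) (p 11) t \<in> Q 3"
      using outer[of 3] by (auto simp: Q_def cell_mod)
    then show "B (p 7) > 0" using affine_start_neg[OF aff'(2), of s t "p 7" "p 11"] S0 S3 by simp
  qed
  have on': "A (p 0) = 0" "A (p 2) = 0" "A (p 5) = 0" "A (p 7) = 0"
    "B (p 1) = 0" "B (p 3) = 0" "B (p 4) = 0" "B (p 6) = 0"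
    using on by (simp_all add: A_def B_def)
  have obj_E: "Inr (0, 8) \<in> graph_objects wheel_V wheel_E" "Inr (1, 9) \<in> graph_objects wheel_V wheel_E"
    "Inr (2, 10) \<in> graph_objects wheel_V wheel_E" "Inr (3, 11) \<in> graph_objects wheel_V wheel_E"
    "Inr (4, 8) \<in> graph_objects wheel_V wheel_E" "Inr (5, 9) \<in> graph_objects wheel_V wheel_E"
    "Inr (6, 10) \<in> graph_objects wheel_V wheel_E" "Inr (7, 11) \<in> graph_objects wheel_V wheel_E"
    using goE[of 0] goE[of 1] goE[of 2] goE[of 3] goE[of 4] goE[of 5] goE[of 6] goE[of 7] by simp_all
  \<comment> \<open>\<open>p 3\<close> and \<open>p 1\<close> lie on \<open>L 0\<close> on opposite
    sides of \<open>A = 0\<close>; as reference pair they show that \<open>A\<close> increases along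
    \<open>L 0\<close>.\<close>
  have ordA: "\<exists>x y. x \<in> Ob X \<and> B x = 0 \<and> y \<in> Ob Y \<and> B y = 0 \<and> A x < A y"
    if "spoke_axis 0 s \<in> obj wheel_pos wheel_edge X" "spoke_axis 0 t \<in> obj wheel_pos wheel_edge Y" "s < t"
      "X \<in> graph_objects wheel_V wheel_E" "Y \<in> graph_objects wheel_V wheel_E" for X Y s t
  proof -
    have "curve_meets_before (line_curve (L 0)) {p 3} {p 1}"
      using order[of 0 "Inl 3" "Inl 1" "-1" 1] wheel_on_spoke_axis(1,2) go by (simp add: Ob_simps)
    moreover have "A (p 3) < A (p 1)" using a by simp
    moreover have "curve_meets_before (line_curve (L 0)) (Ob X) (Ob Y)" using order[of 0 X Y s t] that by simp
    ultimately show ?thesis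
      by (rule affine_order_along_line[OF aff(1)]) (auto simp: zero_iff simp del: range_eqI)
  qed
  have ordB: "\<exists>x y. x \<in> Ob X \<and> A x = 0 \<and> y \<in> Ob Y \<and> A y = 0 \<and> B x < B y"
    if "spoke_axis 1 s \<in> obj wheel_pos wheel_edge X" "spoke_axis 1 t \<in> obj wheel_pos wheel_edge Y" "s < t"
      "X \<in> graph_objects wheel_V wheel_E" "Y \<in> graph_objects wheel_V wheel_E" for X Y s t
  proof -
    have "curve_meets_before (line_curve (L 1)) {p 0} {p 2}"
      using order[of 1 "Inl 0" "Inl 2" "-1" 1] wheel_on_spoke_axis(3,4) go by (simp add: Ob_simps)
    moreover have "B (p 0) < B (p 2)" using a by simp
    moreover have "curve_meets_before (line_curve (L 1)) (Ob X) (Ob Y)" using order[of 1 X Y s t] that by simp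
    ultimately show ?thesis
      by (rule affine_order_along_line[OF aff(2)]) (auto simp: zero_iff simp del: range_eqI)
  qed
  note on_axis = wheel_on_spoke_axis
  \<comment> \<open>On ray 0, with \<open>F = A\<close> and \<open>G = B\<close>, the order outwards
    is \<open>p 1\<close>, the inner edge of arm 0, the outer edge of arm 3.\<close>
  have q0: "A (p 1) * B (p 8) < - B (p 0) * A (p 8)" "A (p 8) < A (p 11)"
  proof -
    obtain d where d: "d \<in> closed_segment (p 0) (p 8)" "B d = 0" "A (p 1) < A d"
      using ordA[OF on_axis(1,5)] go[of 1] obj_E by (auto simp: Ob_simps)
    obtain c c' where c: "c \<in> closed_segment (p 0) (p 8)" "B c = 0"
      "c' \<in> closed_segment (p 7) (p 11)" "B c' = 0" "A c < A c'"
      using ordA[OF on_axis(5,9)] obj_E by (auto simp: Ob_simps)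
    note q = quarter_turn[OF aff(1) aff(2) inj, of "p 0" "p 8" "p 7" "p 11" c c' "p 1" d]
    show "A (p 1) * B (p 8) < - B (p 0) * A (p 8)" "A (p 8) < A (p 11)"
      using q disj[of 0 3] on' a b u c d by auto
  qed
  \<comment> \<open>Each further ray turns the coordinates by a quarter: \<open>(F, G)\<close>
    becomes \<open>(B, -A)\<close>, then \<open>(-A, -B)\<close>, then
    \<open>(-B, A)\<close>.\<close>
  have q1: "B (p 2) * - A (p 9) < A (p 1) * B (p 9)" "B (p 9) < B (p 8)"
  proof -
    obtain d where d: "d \<in> closed_segment (p 1) (p 9)" "A d = 0" "B (p 2) < B d"
      using ordB[OF on_axis(3,7)] go[of 2] obj_E by (auto simp: Ob_simps)
    obtain c c' where c: "c \<in> closed_segment (p 1) (p 9)" "A c = 0"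
      "c' \<in> closed_segment (p 4) (p 8)" "A c' = 0" "B c < B c'"
      using ordB[OF on_axis(7,11)] obj_E by (auto simp: Ob_simps)
    note q = quarter_turn[OF aff(2) aff'(1), of "p 1" "p 9" "p 4" "p 8" c c' "p 2" d]
    show "B (p 2) * - A (p 9) < A (p 1) * B (p 9)" "B (p 9) < B (p 8)"
      using q inj disj[of 1 0] on' a b u c d by auto
  qed
  have q2: "- A (p 3) * - B (p 10) < B (p 2) * - A (p 10)" "- A (p 10) < - A (p 9)"
  proof -
    \<comment> \<open>Rays 2 and 3 follow the negative half axes, so there the object farther from
      the origin comes first in the parameter order.\<close>
    obtain d where d: "d \<in> closed_segment (p 2) (p 10)" "B d = 0" "A d < A (p 3)"
      using ordA[OF on_axis(6,2)] go[of 3] obj_E by (auto simp: Ob_simps)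
    obtain c c' where c: "c \<in> closed_segment (p 2) (p 10)" "B c = 0"
      "c' \<in> closed_segment (p 5) (p 9)" "B c' = 0" "A c' < A c"
      using ordA[OF on_axis(10,6)] obj_E by (auto simp: Ob_simps)
    note q = quarter_turn[OF aff'(1) aff'(2), of "p 2" "p 10" "p 5" "p 9" c c' "p 3" d]
    show "- A (p 3) * - B (p 10) < B (p 2) * - A (p 10)" "- A (p 10) < - A (p 9)"
      using q inj disj[of 2 1] on' a b u c d by auto
  qed
  have q3: "- B (p 0) * A (p 11) < - A (p 3) * - B (p 11)" "- B (p 11) < - B (p 10)"
  proof -
    obtain d where d: "d \<in> closed_segment (p 3) (p 11)" "A d = 0" "B d < B (p 0)"
      using ordB[OF on_axis(8,4)] go[of 0] obj_E by (auto simp: Ob_simps)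
    obtain c c' where c: "c \<in> closed_segment (p 3) (p 11)" "A c = 0"
      "c' \<in> closed_segment (p 6) (p 10)" "A c' = 0" "B c' < B c"
      using ordB[OF on_axis(12,8)] obj_E by (auto simp: Ob_simps)
    note q = quarter_turn[OF aff'(2) aff(1), of "p 3" "p 11" "p 6" "p 10" c c' "p 0" d]
    show "- B (p 0) * A (p 11) < - A (p 3) * - B (p 11)" "- B (p 11) < - B (p 10)"
      using q inj disj[of 3 2] on' a b u c d by auto
  qed
  \<comment> \<open>Each link joins the two inequalities of one ray; the rays 0, 3, 2, 1 in turn
    close a strict cycle.\<close>
  have "A (p 1) * B (p 8) < - B (p 0) * A (p 11)"
    using q0 a by (meson less_trans mult_strict_left_mono neg_0_less_iff_less)
  also have "\<dots> < - A (p 3) * - B (p 10)"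
    using q3 a by (meson less_trans mult_strict_left_mono neg_0_less_iff_less)
  also have "\<dots> < B (p 2) * - A (p 9)"
    using q2 a by (meson less_trans mult_strict_left_mono neg_0_less_iff_less)
  also have "\<dots> < A (p 1) * B (p 8)"
    using q1 a by (meson less_trans mult_strict_left_mono neg_0_less_iff_less)
  finally show False .
qed

theorem theorem1:
  shows "\<exists>(V::nat set) (E::(nat \<times> nat) set) (pos::nat \<Rightarrow> pt) (c::nat \<times> nat \<Rightarrow> real \<Rightarrow> pt)
           (X::nat \<Rightarrow> real \<Rightarrow> pt).
     star_aligned_graph V E pos c 2 X \<and>
     alignment_complexity E pos c 2 X None (Some 1) None \<and>
     (\<forall>e\<in>E. (on_pl 2 X (pos (fst e)) \<longleftrightarrow> \<not> on_pl 2 X (pos (snd e))) \<and> crossing_number c 2 X e \<le> 1) \<and>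
     \<not> (\<exists>p L. aligned_drawing V E pos c 2 X p L)"
proof (intro exI conjI ballI)
  show "star_aligned_graph wheel_V wheel_E wheel_pos wheel_edge 2 spoke_axis"
    by (rule wheel_star_aligned)
  show "alignment_complexity wheel_E wheel_pos wheel_edge 2 spoke_axis None (Some 1) None"
    by (rule wheel_alignment_complexity)
  show "\<not> (\<exists>p L. aligned_drawing wheel_V wheel_E wheel_pos wheel_edge 2 spoke_axis p L)"
    by (simp add: no_aligned_drawing_wheel)
  fix e assume e: "e \<in> wheel_E"
  show "on_pl 2 spoke_axis (wheel_pos (fst e)) \<longleftrightarrow> \<not> on_pl 2 spoke_axis (wheel_pos (snd e))"
    using wheel_anchored_once[OF e] by simp
  show "crossing_number wheel_edge 2 spoke_axis e \<le> 1"
    using e by (rule wheel_crossing_number)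
qed

end
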